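(* Let $\mathcal H$ be a separable Hilbert space and $|||\cdot|||$ a unitarily-invariant norm for $B(\mathcal H)$ such that $|||h|||_{\mathrm{CL}([0,\infty))}=\|h\|_{\mathrm{Lip}([0,\infty))}$ for every Lipschitz function $h$ on $[0,\infty)$. Let $A,X\in B(\mathcal H)$ with $A\ge 0$ and $|||X|||\le 1$. Let $f\ge 0$ be a concave function on $[0,\infty)$. Then $$|||[f(A),X]|||\le f\big(|||[A,X]|||\big).$$
   Context: $B(\mathcal H)$ is the space of bounded operators on $\mathcal H$, and $[A,X]=AX-XA$. A unitarily-invariant norm for $B(\mathcal H)$ is a norm $|||\cdot|||$ defined on a (closed, i.e. complete in $|||\cdot|||$) two-sided ideal $\mathscr J$ of $B(\mathcal H)$ such that $|||UXV|||=|||X|||$ for all unitaries $U,V\in B(\mathcal H)$ and $X\in\mathscr J$; such norms satisfy $|||XYZ|||\le\|X\|\,|||Y|||\,\|Z\|$ for $X,Z\in B(\mathcal H)$, $Y\in\mathscr J$, where $\|\cdot\|$ is the operator norm. Writing $|||X|||\le 1$ includes $X\in\mathscr J$. For a set $\mathfrak F\subset\mathbb R$ and a function $h$ on $\mathfrak F$, $|||h|||_{\mathrm{CL}(\mathfrak F)}$ (the commutator $|||\cdot|||$-Lipschitz norm) is the smallest constant $K$ such that $|||[h(S),Y]|||\le K\,|||[S,Y]|||$ for all self-adjoint $S\in B(\mathcal H)$ with spectrum in $\mathfrak F$ and all $Y\in\mathscr J$. $\|h\|_{\mathrm{Lip}([0,\infty))}$ is the usual (smallest) Lipschitz constant of $h$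 on $[0,\infty)$. $f(A)$ is defined by the functional calculus. *)

theory Defs
  imports "HOL-Analysis.Analysis"
begin

section \<open>Complex Hilbert spaces\<close>

text \<open>The inner product is conjugate-linear in the first and linear in the second argument.
  Its symmetry makes \<^term>\<open>cinner x x\<close> real, and the last axiom makes it
  nonnegative and definite, because \<^term>\<open>norm\<close> is a norm and \<^term>\<open>sqrt\<close>
  is an odd function.\<close>

class complex_hilbert_space = banach +
  fixes scaleC :: "complex \<Rightarrow> 'a \<Rightarrow> 'a"  (infixr "*\<^sub>C" 75)
    and cinner :: "'a \<Rightarrow> 'a \<Rightarrow> complex"
  assumes scaleC_add_right: "c *\<^sub>C (x + y) = c *\<^sub>C x + c *\<^sub>C y"
    and scaleC_add_left: "(c + d) *\<^sub>C x = c *\<^sub>C x + d *\<^sub>C x"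
    and scaleC_scaleC: "c *\<^sub>C (d *\<^sub>C x) = (c * d) *\<^sub>C x"
    and scaleC_of_real: "complex_of_real r *\<^sub>C x = r *\<^sub>R x"
    and cinner_commute: "cinner x y = cnj (cinner y x)"
    and cinner_add_right: "cinner x (y + z) = cinner x y + cinner x z"
    and cinner_scaleC_right: "cinner x (c *\<^sub>C y) = c * cinner x y"
    and norm_eq_sqrt_cinner: "norm x = sqrt (Re (cinner x x))"

lemma norm_scaleC:
  fixes x :: "'a :: complex_hilbert_space"
  shows "norm (c *\<^sub>C x) = cmod c * norm x"
proof -
  have sq: "(norm y)\<^sup>2 = Re (cinner y y)" for y :: 'a
  proof -
    have "0 \<le> sqrt (Re (cinner y y))"
      using norm_ge_zero [of y] by (simp only: norm_eq_sqrt_cinner)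
    then show ?thesis
      by (simp add: norm_eq_sqrt_cinner)
  qed
  have left: "cinner (c *\<^sub>C x) y = cnj c * cinner x y" for y
  proof -
    have "cinner (c *\<^sub>C x) y = cnj (c * cinner y x)"
      by (subst cinner_commute) (simp only: cinner_scaleC_right)
    also have "\<dots> = cnj c * cinner x y"
      by (simp only: complex_cnj_mult cinner_commute [of x y])
    finally show ?thesis .
  qed
  have "cinner (c *\<^sub>C x) (c *\<^sub>C x) = (c * cnj c) * cinner x x"
    unfolding left cinner_scaleC_right by (simp only: ac_simps)
  also have "\<dots> = complex_of_real ((cmod c)\<^sup>2) * cinner x x"
    by (simp only: complex_norm_square)
  finally have "Re (cinner (c *\<^sub>C x) (c *\<^sub>C x)) = (cmod c)\<^sup>2 * Re (cinner x x)"
    by (simp only: Re_complex_of_real Im_complex_of_real times_complex.simps)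
  then have "(norm (c *\<^sub>C x))\<^sup>2 = (cmod c * norm x)\<^sup>2"
    by (simp only: sq power_mult_distrib)
  then show ?thesis
    by (rule power2_eq_imp_eq) simp_all
qed


section \<open>Bounded operators\<close>

text \<open>The type \<^typ>\<open>'a \<Rightarrow>\<^sub>L 'a\<close> consists of the bounded real-linear
  operators; the algebra of bounded operators of the complex Hilbert space is cut out of it.
  The norm of this type is the operator norm.\<close>

definition bounded_ops :: "('a::complex_hilbert_space \<Rightarrow>\<^sub>L 'a) set" where
  "bounded_ops = {A :: _ \<Rightarrow>\<^sub>L _. \<forall>c x. A (c *\<^sub>C x) = c *\<^sub>C A x}"

lift_definition scaleC_op ::
  "complex \<Rightarrow> ('a::complex_hilbert_space \<Rightarrow>\<^sub>L 'a) \<Rightarrow> ('a \<Rightarrow>\<^sub>L 'a)"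
  is "\<lambda>c A x. c *\<^sub>C A x"
proof -
  fix c and A :: "'a \<Rightarrow> 'a"
  assume "bounded_linear A"
  then interpret A: bounded_linear A .
  obtain K where K: "\<And>x. norm (A x) \<le> norm x * K"
    using A.bounded by blast
  show "bounded_linear (\<lambda>x. c *\<^sub>C A x)"
  proof (rule bounded_linear_intro)
    show "c *\<^sub>C A (x + y) = c *\<^sub>C A x + c *\<^sub>C A y" for x y
      by (simp add: A.add scaleC_add_right)
    show "c *\<^sub>C A (r *\<^sub>R x) = r *\<^sub>R (c *\<^sub>C A x)" for r x
      by (simp only: A.scaleR) (simp only: scaleC_of_real [symmetric] scaleC_scaleC mult.commute)
    show "norm (c *\<^sub>C A x) \<le> norm x * (cmod c * K)" for x
      using mult_left_mono [OF K [of x], of "cmod c"] by (simp add: norm_scaleC ac_simps)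
  qed
qed

definition commutator :: "('a::complex_hilbert_space \<Rightarrow>\<^sub>L 'a) \<Rightarrow> ('a \<Rightarrow>\<^sub>L 'a) \<Rightarrow> ('a \<Rightarrow>\<^sub>L 'a)" where
  "commutator A X = (A o\<^sub>L X) - (X o\<^sub>L A)"

definition self_adjoint :: "('a::complex_hilbert_space \<Rightarrow>\<^sub>L 'a) \<Rightarrow> bool" where
  "self_adjoint A \<longleftrightarrow> A \<in> bounded_ops \<and> (\<forall>x y. cinner (A x) y = cinner x (A y))"

definition positive_op :: "('a::complex_hilbert_space \<Rightarrow>\<^sub>L 'a) \<Rightarrow> bool" where
  "positive_op A \<longleftrightarrow> self_adjoint A \<and> (\<forall>x. 0 \<le> Re (cinner x (A x)))"

definition unitary_op :: "('a::complex_hilbert_space \<Rightarrow>\<^sub>L 'a) \<Rightarrow> bool" where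
  "unitary_op U \<longleftrightarrow> U \<in> bounded_ops \<and> surj (blinfun_apply U) \<and>
     (\<forall>x y. cinner (U x) (U y) = cinner x y)"

definition spectrum :: "('a::complex_hilbert_space \<Rightarrow>\<^sub>L 'a) \<Rightarrow> complex set" where
  "spectrum A = {z. \<not> (\<exists>B\<in>bounded_ops.
     B o\<^sub>L (A - scaleC_op z id_blinfun) = id_blinfun \<and>
     (A - scaleC_op z id_blinfun) o\<^sub>L B = id_blinfun)}"


section \<open>Functional calculus of a self-adjoint operator\<close>

text \<open>A concave function on the half-line may jump at 0, so the calculus for continuous
  functions does not suffice and the one for bounded Borel functions on the spectrum is used.
  Only real-valued functions are needed; self-adjointness of the values then expresses
  compatibility with the involution.\<close>

definition real_spectrum :: "('a::complex_hilbert_space \<Rightarrow>\<^sub>L 'a) \<Rightarrow> real set" where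
  "real_spectrum A = {t. complex_of_real t \<in> spectrum A}"

definition bounded_borel_on :: "real set \<Rightarrow> (real \<Rightarrow> real) set" where
  "bounded_borel_on F = {f. f \<in> borel_measurable (restrict_space borel F) \<and> bounded (f ` F)}"

definition borel_calculus ::
  "('a::complex_hilbert_space \<Rightarrow>\<^sub>L 'a) \<Rightarrow> ((real \<Rightarrow> real) \<Rightarrow> ('a \<Rightarrow>\<^sub>L 'a)) \<Rightarrow> bool" where
  "borel_calculus A \<Phi> \<longleftrightarrow>
    (let \<sigma> = real_spectrum A; \<B> = bounded_borel_on \<sigma> in
      (\<forall>f\<in>\<B>. self_adjoint (\<Phi> f)) \<and>
      (\<forall>f\<in>\<B>. \<forall>g\<in>\<B>. (\<forall>t\<in>\<sigma>. f t = g t) \<longrightarrow> \<Phi> f = \<Phi> g) \<and>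
      (\<forall>f\<in>\<B>. \<forall>g\<in>\<B>. \<Phi> (\<lambda>t. f t + g t) = \<Phi> f + \<Phi> g) \<and>
      (\<forall>f\<in>\<B>. \<forall>c. \<Phi> (\<lambda>t. c * f t) = c *\<^sub>R \<Phi> f) \<and>
      (\<forall>f\<in>\<B>. \<forall>g\<in>\<B>. \<Phi> (\<lambda>t. f t * g t) = \<Phi> f o\<^sub>L \<Phi> g) \<and>
      \<Phi> (\<lambda>t. 1) = id_blinfun \<and>
      \<Phi> (\<lambda>t. t) = A \<and>
      (\<forall>F. \<forall>f\<in>\<B>. \<forall>M.
         (\<forall>n. F n \<in> \<B>) \<and> (\<forall>n. \<forall>t\<in>\<sigma>. \<bar>F n t\<bar> \<le> M) \<and> (\<forall>t\<in>\<sigma>. (\<lambda>n. F n t) \<longlonglongrightarrow> f t) \<longrightarrow>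
         (\<forall>x. (\<lambda>n. \<Phi> (F n) x) \<longlonglongrightarrow> \<Phi> f x)))"

text \<open>For self-adjoint \<open>A\<close> such a calculus exists by the spectral theorem, and its values
  on bounded Borel functions on the spectrum are unique: multiplicativity and linearity determine
  it on polynomials, and the class of functions on which two calculi agree is closed under
  bounded pointwise limits. The choice operator therefore makes no actual choice on the
  functions of interest.\<close>

definition fun_calc :: "(real \<Rightarrow> real) \<Rightarrow> ('a::complex_hilbert_space \<Rightarrow>\<^sub>L 'a) \<Rightarrow> ('a \<Rightarrow>\<^sub>L 'a)" where
  "fun_calc f A = (SOME \<Phi>. borel_calculus A \<Phi>) f"


section \<open>Unitarily invariant norms\<close>

text \<open>The norm \<open>N\<close> lives on the ideal \<open>J\<close>; its values outside of \<open>J\<close> are irrelevant.\<close>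

definition two_sided_ideal :: "('a::complex_hilbert_space \<Rightarrow>\<^sub>L 'a) set \<Rightarrow> bool" where
  "two_sided_ideal J \<longleftrightarrow> J \<subseteq> bounded_ops \<and> 0 \<in> J \<and>
     (\<forall>X\<in>J. \<forall>Y\<in>J. X + Y \<in> J) \<and>
     (\<forall>c. \<forall>X\<in>J. scaleC_op c X \<in> J) \<and>
     (\<forall>A\<in>bounded_ops. \<forall>X\<in>J. A o\<^sub>L X \<in> J \<and> X o\<^sub>L A \<in> J)"

definition norm_on ::
  "('a::complex_hilbert_space \<Rightarrow>\<^sub>L 'a) set \<Rightarrow> (('a \<Rightarrow>\<^sub>L 'a) \<Rightarrow> real) \<Rightarrow> bool" where
  "norm_on J N \<longleftrightarrow>
     (\<forall>X\<in>J. 0 \<le> N X \<and> (N X = 0 \<longleftrightarrow> X = 0)) \<and>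
     (\<forall>c. \<forall>X\<in>J. N (scaleC_op c X) = cmod c * N X) \<and>
     (\<forall>X\<in>J. \<forall>Y\<in>J. N (X + Y) \<le> N X + N Y)"

definition complete_norm_on ::
  "('a::complex_hilbert_space \<Rightarrow>\<^sub>L 'a) set \<Rightarrow> (('a \<Rightarrow>\<^sub>L 'a) \<Rightarrow> real) \<Rightarrow> bool" where
  "complete_norm_on J N \<longleftrightarrow>
     (\<forall>X. (\<forall>n. X n \<in> J) \<and> (\<forall>e>0. \<exists>n0. \<forall>m\<ge>n0. \<forall>n\<ge>n0. N (X m - X n) < e) \<longrightarrow>
        (\<exists>L\<in>J. (\<lambda>n. N (X n - L)) \<longlonglongrightarrow> 0))"

definition unitarily_invariant_norm ::
  "('a::complex_hilbert_space \<Rightarrow>\<^sub>L 'a) set \<Rightarrow> (('a \<Rightarrow>\<^sub>L 'a) \<Rightarrow> real) \<Rightarrow> bool" where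
  "unitarily_invariant_norm J N \<longleftrightarrow>
     two_sided_ideal J \<and> norm_on J N \<and> complete_norm_on J N \<and>
     (\<forall>U V. \<forall>X\<in>J. unitary_op U \<and> unitary_op V \<longrightarrow> N (U o\<^sub>L X o\<^sub>L V) = N X)"


section \<open>Lipschitz and commutator Lipschitz norms\<close>

text \<open>Both are the infimum of all admissible constants \<open>K \<ge> 0\<close>, with value
  \<open>\<infinity>\<close> if there is none; a finite infimum is attained.\<close>

definition commutator_lipschitz_norm ::
  "('a::complex_hilbert_space \<Rightarrow>\<^sub>L 'a) set \<Rightarrow> (('a \<Rightarrow>\<^sub>L 'a) \<Rightarrow> real) \<Rightarrow> real set \<Rightarrow>
   (real \<Rightarrow> real) \<Rightarrow> ereal" where
  "commutator_lipschitz_norm J N F h =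
     Inf {ereal K | K. 0 \<le> K \<and>
       (\<forall>S Y. self_adjoint S \<and> spectrum S \<subseteq> complex_of_real ` F \<and> Y \<in> J \<longrightarrow>
          N (commutator (fun_calc h S) Y) \<le> K * N (commutator S Y))}"

definition lipschitz_norm :: "real set \<Rightarrow> (real \<Rightarrow> real) \<Rightarrow> ereal" where
  "lipschitz_norm F h = Inf {ereal K | K. K-lipschitz_on F h}"

end

theory Submission
  imports Defs "HOL-Probability.Helly_Selection"
begin

text \<open>The inequality is an interpolation argument. Put \<open>\<delta> = N (commutator A X)\<close> and suppose
\<open>\<delta> > 0\<close>. A concave nonnegative \<open>f\<close> is nondecreasing and has a supporting line of some slope
\<open>c \<ge> 0\<close> at \<open>\<delta>\<close>. Replacing \<open>f\<close> by this line to the left of \<open>\<delta>\<close> gives a \<open>c\<close>-Lipschitz function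
\<open>h\<close>, and the remainder \<open>g = f - h\<close> takes values in an interval of length
\<open>f \<delta> - c * \<delta>\<close>. The hypothesis on commutator Lipschitz norms bounds the commutator of \<open>h(A)\<close> by
\<open>c * \<delta>\<close>. For \<open>g\<close>, subtracting the midpoint of its range does not change the commutator, so the norm of
the commutator is at most the length of that range times \<open>N X \<le> 1\<close>. The two bounds add up to
\<open>f \<delta>\<close>. When \<open>\<delta> = 0\<close>, \<open>X\<close> commutes with every Lipschitz function of \<open>A\<close>; since \<open>f\<close> is a bounded
pointwise limit on the spectrum of Lipschitz functions, even if it jumps at 0, \<open>X\<close> commutes with
\<open>f(A)\<close>. This is \<^emph>\<open>N_commutator_concave\<close>.

Two ingredients have to be supplied. First, that multiplication by a contraction \<open>u(A)\<close> does not
increase \<open>N\<close>: the operators \<open>u(A) \<plusminus> \<i> sqrt (1 - u\<^sup>2)(A)\<close> are unitary and their mean is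
\<open>u(A)\<close> (\<^emph>\<open>N_contraction_compose\<close>).

Second, the spectral theorem: \<open>fun_calc\<close> is a choice from the Borel calculi of \<open>A\<close>, so one has to
exist. Let \<open>0 \<le> A \<le> M\<close>. For a vector \<open>x\<close> the numbers \<open>\<langle>x, A^i (M - A)^j x\<rangle>\<close> are nonnegative
and satisfy Pascal's rule up to the factor \<open>M\<close>; by Hausdorff's theorem the numbers
\<open>\<langle>x, A^i x\<rangle>\<close> are the moments of a finite measure \<open>\<mu>\<close> on \<open>[0, M]\<close> that depends on \<open>x\<close>. The measure
is a weak limit of Bernstein sums, found by Helly selection. It follows that
\<open>\<parallel>p(A) x\<parallel>\<^sup>2 = \<integral> p\<^sup>2 d\<mu>\<close> for polynomials \<open>p\<close>, so \<open>p \<mapsto> p(A) x\<close> is an isometry on a dense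
subspace of \<open>L\<^sup>2(\<mu>)\<close>, and \<open>f(A) x\<close> is its extension to \<open>f\<close>. The algebraic laws
are inherited from polynomials because one sequence of polynomials can approximate \<open>f\<close> in the spaces of
finitely many vectors at once, and dominated convergence gives continuity under bounded pointwise
limits. The calculus vanishes on functions that vanish on the spectrum, because near a point \<open>t\<close> where
\<open>A - t\<close> is bounded below, vectors in the range of the spectral projection would be almost
eigenvectors.\<close>

section \<open>The Hausdorff moment problem\<close>

text \<open>Pascal's rule, in the form in which it drives inductions over binomial sums.\<close>

lemma sum_binomial_Suc:
  fixes g :: "nat \<Rightarrow> real"
  shows "(\<Sum>k\<le>Suc n. real (Suc n choose k) * g k) = (\<Sum>k\<le>n. real (n choose k) * (g k + g (Suc k)))"
proof -
  have "(\<Sum>k\<le>Suc n. real (Suc n choose k) * g k)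
      = g 0 + (\<Sum>k\<le>n. real (Suc n choose Suc k) * g (Suc k))"
    by (subst sum.atMost_Suc_shift) simp
  also have "(\<Sum>k\<le>n. real (Suc n choose Suc k) * g (Suc k))
      = (\<Sum>k\<le>n. real (n choose k) * g (Suc k)) + (\<Sum>k\<le>n. real (n choose Suc k) * g (Suc k))"
    by (simp add: sum.distrib[symmetric] algebra_simps)
  also have "(\<Sum>k\<le>n. real (n choose Suc k) * g (Suc k)) = (\<Sum>k\<le>Suc n. real (n choose k) * g k) - g 0"
    by (subst sum.atMost_Suc_shift) simp
  also have "(\<Sum>k\<le>Suc n. real (n choose k) * g k) = (\<Sum>k\<le>n. real (n choose k) * g k)"
    by simp
  finally show ?thesis
    by (simp add: sum.distrib[symmetric] algebra_simps)
qed

text \<open>Each entry is the sum of its two successors, so after \<open>n\<close> steps it is spread over the paths of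
length \<open>n\<close>. For \<open>i = j = 0\<close> these are the weights of the Bernstein measure of order \<open>n\<close>.\<close>

lemma moment_array_binomial_sum:
  fixes m :: "nat \<Rightarrow> nat \<Rightarrow> real"
  assumes rec: "\<And>i j. m i j = m (Suc i) j + m i (Suc j)"
  shows "(\<Sum>k\<le>n. real (n choose k) * m (i + k) (j + (n - k))) = m i j"
proof (induction n)
  case (Suc n)
  have "(\<Sum>k\<le>Suc n. real (Suc n choose k) * m (i + k) (j + (Suc n - k)))
      = (\<Sum>k\<le>n. real (n choose k) * (m (i + k) (j + (Suc n - k)) + m (i + Suc k) (j + (n - k))))"
    by (subst sum_binomial_Suc) simp
  also have "\<dots> = (\<Sum>k\<le>n. real (n choose k) * m (i + k) (j + (n - k)))"
  proof (rule sum.cong)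
    fix k assume "k \<in> {..n}"
    then show "real (n choose k) * (m (i + k) (j + (Suc n - k)) + m (i + Suc k) (j + (n - k)))
        = real (n choose k) * m (i + k) (j + (n - k))"
      using rec[of "i + k" "j + (n - k)"] by (simp add: Suc_diff_le)
  qed simp
  finally show ?case using Suc by simp
qed simp

lemma abs_power_diff_le:
  fixes a b :: real
  assumes "0 \<le> a" "a \<le> 1" "0 \<le> b" "b \<le> 1"
  shows "\<bar>a ^ j - b ^ j\<bar> \<le> real j * \<bar>a - b\<bar>"
  using norm_power_diff[of a b j] assms by simp

lemma nat_fraction_le_1: "k \<le> n \<Longrightarrow> real k / real n \<le> 1"
  by (cases "n = 0") auto

text \<open>The \<open>j\<close>-th moments of the Bernstein measures. Since \<open>k/n * (n choose k)\<close> is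
\<open>(n - 1) choose (k - 1)\<close>, one factor \<open>k/n\<close> can be traded for a step from \<open>i\<close> to \<open>Suc i\<close>, up to an
error of order \<open>1/n\<close> caused by replacing \<open>(k + 1)/(n + 1)\<close> by \<open>k/n\<close> in the remaining factors. The index \<open>i\<close> is
carried along for this induction.\<close>

lemma bernstein_moment_tendsto:
  fixes m :: "nat \<Rightarrow> nat \<Rightarrow> real"
  assumes nonneg: "\<And>i j. 0 \<le> m i j"
    and rec: "\<And>i j. m i j = m (Suc i) j + m i (Suc j)"
  shows "(\<lambda>n. \<Sum>k\<le>n. (real k / real n) ^ j * (real (n choose k) * m (i + k) (n - k))) \<longlonglongrightarrow> m (i + j) 0"
proof (induction j arbitrary: i)
  case 0
  then show ?case
    using moment_array_binomial_sum[of m, OF rec, where i = i and j = 0] by simp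
next
  case (Suc j)
  define L where "L n j i = (\<Sum>k\<le>n. (real k / real n) ^ j * (real (n choose k) * m (i + k) (n - k)))" for n j i
  have shift: "L (Suc n) (Suc j) i
      = (\<Sum>k\<le>n. (real (Suc k) / real (Suc n)) ^ j * (real (n choose k) * m (Suc i + k) (n - k)))" for n
  proof -
    have "L (Suc n) (Suc j) i = (\<Sum>k\<le>n. (real (Suc k) / real (Suc n)) ^ Suc j
        * (real (Suc n choose Suc k) * m (i + Suc k) (n - k)))"
      unfolding L_def by (subst sum.atMost_Suc_shift) simp
    also have "\<dots> = (\<Sum>k\<le>n. (real (Suc k) / real (Suc n)) ^ j * (real (n choose k) * m (Suc i + k) (n - k)))"
    proof (rule sum.cong)
      fix k
      have "real (Suc k) * real (Suc n choose Suc k) = real (Suc n) * real (n choose k)"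
        by (simp only: of_nat_mult[symmetric] Suc_times_binomial)
      then have "real (Suc k) / real (Suc n) * real (Suc n choose Suc k) = real (n choose k)"
        by (simp add: field_simps del: of_nat_Suc)
      then have "(real (Suc k) / real (Suc n) * real (Suc n choose Suc k)) * ((real (Suc k) / real (Suc n)) ^ j * m (i + Suc k) (n - k))
          = real (n choose k) * ((real (Suc k) / real (Suc n)) ^ j * m (i + Suc k) (n - k))"
        by (simp only: )
      then show "(real (Suc k) / real (Suc n)) ^ Suc j * (real (Suc n choose Suc k) * m (i + Suc k) (n - k))
          = (real (Suc k) / real (Suc n)) ^ j * (real (n choose k) * m (Suc i + k) (n - k))"
        unfolding power_Suc by (simp only: ac_simps add_Suc add_Suc_right)
    qed simp
    finally show ?thesis .
  qed
  have close: "\<bar>L (Suc n) (Suc j) i - L n j (Suc i)\<bar> \<le> real j * m (Suc i) 0 * (1 / real (Suc n))" for n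
  proof -
    have "\<bar>L (Suc n) (Suc j) i - L n j (Suc i)\<bar>
        = \<bar>\<Sum>k\<le>n. ((real (Suc k) / real (Suc n)) ^ j - (real k / real n) ^ j) * (real (n choose k) * m (Suc i + k) (n - k))\<bar>"
      unfolding shift by (simp add: L_def sum_subtractf[symmetric] left_diff_distrib)
    also have "\<dots> \<le> (\<Sum>k\<le>n. (real j * (1 / real (Suc n))) * (real (n choose k) * m (Suc i + k) (n - k)))"
    proof (rule order_trans[OF sum_abs sum_mono])
      fix k assume k: "k \<in> {..n}"
      have d: "\<bar>real (Suc k) / real (Suc n) - real k / real n\<bar> \<le> 1 / real (Suc n)"
      proof (cases "n = 0")
        case False
        then have "real (Suc k) / real (Suc n) - real k / real n = (real n - real k) / real n * (1 / real (Suc n))"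
          by (simp add: field_simps)
        moreover have "0 \<le> (real n - real k) / real n" "(real n - real k) / real n \<le> 1"
          using k False by (auto simp: field_simps)
        ultimately have "\<bar>real (Suc k) / real (Suc n) - real k / real n\<bar> = (real n - real k) / real n * (1 / real (Suc n))"
          using k by (simp only: abs_mult) (simp del: of_nat_Suc)
        also have "\<dots> \<le> 1 * (1 / real (Suc n))"
          using \<open>(real n - real k) / real n \<le> 1\<close> by (intro mult_right_mono) auto
        finally show ?thesis by simp
      qed (use k in simp)
      have "\<bar>(real (Suc k) / real (Suc n)) ^ j - (real k / real n) ^ j\<bar>
          \<le> real j * \<bar>real (Suc k) / real (Suc n) - real k / real n\<bar>"
        using k by (intro abs_power_diff_le) (auto simp: nat_fraction_le_1 simp del: of_nat_Suc)
      also have "\<dots> \<le> real j * (1 / real (Suc n))"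
        using d by (intro mult_left_mono) auto
      finally show "\<bar>((real (Suc k) / real (Suc n)) ^ j - (real k / real n) ^ j) * (real (n choose k) * m (Suc i + k) (n - k))\<bar>
          \<le> (real j * (1 / real (Suc n))) * (real (n choose k) * m (Suc i + k) (n - k))"
        using nonneg[of "Suc i + k" "n - k"]
        by (subst abs_mult) (intro mult_mono; simp)
    qed
    also have "\<dots> = real j * (1 / real (Suc n)) * m (Suc i) 0"
      using moment_array_binomial_sum[of m, OF rec, where n = n and i = "Suc i" and j = 0]
      by (simp only: sum_distrib_left[symmetric] add_0)
    finally show ?thesis by (simp add: ac_simps)
  qed
  have "(\<lambda>n. real j * m (Suc i) 0 * (1 / real (Suc n))) \<longlonglongrightarrow> 0"
    using tendsto_mult[OF tendsto_const LIMSEQ_Suc[OF lim_1_over_n]] by force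
  then have "(\<lambda>n. L (Suc n) (Suc j) i - L n j (Suc i)) \<longlonglongrightarrow> 0"
    by (rule Lim_null_comparison[rotated]) (use close in \<open>auto intro: always_eventually\<close>)
  moreover have "(\<lambda>n. L n j (Suc i)) \<longlonglongrightarrow> m (Suc i + j) 0"
    unfolding L_def by (rule Suc.IH)
  ultimately have "(\<lambda>n. L (Suc n) (Suc j) i) \<longlonglongrightarrow> m (Suc i + j) 0"
    using tendsto_add[of "\<lambda>n. L (Suc n) (Suc j) i - L n j (Suc i)" 0 sequentially "\<lambda>n. L n j (Suc i)"] by simp
  then have "(\<lambda>n. L n (Suc j) i) \<longlonglongrightarrow> m (i + Suc j) 0"
    by (simp add: LIMSEQ_imp_Suc)
  then show ?case unfolding L_def .
qed

text \<open>The Bernstein measures live on \<open>[0, 1]\<close>, so they are tight and a subsequence converges weakly;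
monomials, cut off outside of \<open>[0, 1]\<close>, are bounded and continuous, so their integrals
converge too.\<close>

lemma hausdorff_moment_probability:
  fixes m :: "nat \<Rightarrow> nat \<Rightarrow> real"
  assumes nonneg: "\<And>i j. 0 \<le> m i j"
    and rec: "\<And>i j. m i j = m (Suc i) j + m i (Suc j)"
    and one: "m 0 0 = 1"
  shows "\<exists>\<mu>. real_distribution \<mu> \<and> (AE t in \<mu>. t \<in> {0..1}) \<and> (\<forall>i. (\<integral>t. t ^ i \<partial>\<mu>) = m i 0)"
proof -
  define w where "w n k = real (n choose k) * m k (n - k)" for n k
  have w: "0 \<le> w n k" for n k
    unfolding w_def using nonneg by simp
  have w_sum: "(\<Sum>k\<le>n. w n k) = 1" for n
    using moment_array_binomial_sum[of m, OF rec, where n = n and i = 0 and j = 0] one by (simp add: w_def)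
  define \<nu> where "\<nu> n = distr (point_measure {..n} (w n)) borel (\<lambda>k. real k / real n)" for n
  have prob: "prob_space (\<nu> n)" for n
  proof -
    have "prob_space (point_measure {..n} (w n))"
      by (rule prob_spaceI) (simp add: space_point_measure emeasure_point_measure_finite2 w w_sum)
    then show ?thesis
      unfolding \<nu>_def by (rule prob_space.prob_space_distr) simp
  qed
  have dist: "real_distribution (\<nu> n)" for n
    using prob[of n] by (auto simp: real_distribution_def real_distribution_axioms_def \<nu>_def)
  have integral: "(\<integral>t. g t \<partial>\<nu> n) = (\<Sum>k\<le>n. w n k * g (real k / real n))"
    if "g \<in> borel_measurable borel" for n and g :: "real \<Rightarrow> real"
    unfolding \<nu>_def using that w
    by (subst integral_distr) (auto simp: lebesgue_integral_point_measure_finite)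
  have support: "AE t in \<nu> n. t \<in> {0..1}" for n
    unfolding \<nu>_def by (subst AE_distr_iff) (auto simp: AE_point_measure nat_fraction_le_1)
  have "tight \<nu>"
    unfolding tight_def
  proof (intro conjI allI impI)
    fix \<epsilon> :: real assume "\<epsilon> > 0"
    have "measure (\<nu> n) {-1<..1} = 1" for n
    proof -
      interpret real_distribution "\<nu> n" by (rule dist)
      have "AE t in \<nu> n. t \<in> {-1<..1}"
        using support[of n] by eventually_elim auto
      then show ?thesis
        by (subst prob_eq_1) auto
    qed
    then show "\<exists>a b. a < b \<and> (\<forall>n. 1 - \<epsilon> < measure (\<nu> n) {a<..b})"
      using \<open>\<epsilon> > 0\<close> by (intro exI[of _ "-1"] exI[of _ 1]) auto
  qed (rule dist)
  then obtain r \<mu> where r: "strict_mono (r :: nat \<Rightarrow> nat)" and \<mu>: "real_distribution \<mu>"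
      and weak: "weak_conv_m (\<nu> \<circ> id \<circ> r) \<mu>"
    using tight_imp_convergent_subsubsequence[of \<nu> id] strict_mono_id by (auto simp: id_def)
  interpret \<mu>: real_distribution \<mu> by (rule \<mu>)
  have lim: "(\<lambda>n. \<integral>t. g t \<partial>\<nu> (r n)) \<longlonglongrightarrow> (\<integral>t. g t \<partial>\<mu>)"
    if g: "\<And>t. isCont g t" "\<And>t. \<bar>g t\<bar> \<le> 1" for g :: "real \<Rightarrow> real"
    using weak_conv_imp_integral_bdd_continuous_conv[OF _ \<mu> weak, of g 1] dist g
    by (simp add: o_def)
  have cont_borel: "g \<in> borel_measurable borel" if "\<And>t. isCont g t" for g :: "real \<Rightarrow> real"
    using that by (intro borel_measurable_continuous_onI continuous_at_imp_continuous_on) auto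
  \<comment> \<open>A bounded continuous function that vanishes exactly on the unit interval carries the support to the limit.\<close>
  define dist01 where "dist01 t = min 1 (max 0 (max (- t) (t - 1)))" for t :: real
  have dist01_cont: "isCont dist01 t" for t
    unfolding dist01_def by (intro continuous_intros)
  have dist01_zero: "dist01 t = 0 \<longleftrightarrow> t \<in> {0..1}" for t
    unfolding dist01_def by auto
  have "(\<integral>t. dist01 t \<partial>\<nu> n) = 0" for n
    using support[of n] by (intro integral_eq_zero_AE) (auto simp: dist01_zero)
  then have "(\<integral>t. dist01 t \<partial>\<mu>) = 0"
    using lim[OF dist01_cont] by (simp add: LIMSEQ_const_iff dist01_def)
  moreover have "integrable \<mu> dist01"
    using cont_borel[OF dist01_cont] by (intro \<mu>.integrable_const_bound[where B = 1]) (auto simp: dist01_def)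
  ultimately have "AE t in \<mu>. dist01 t = 0"
    by (subst (asm) integral_nonneg_eq_0_iff_AE) (auto simp: dist01_def)
  then have AE: "AE t in \<mu>. t \<in> {0..1}"
    by (simp add: dist01_zero)
  have "(\<integral>t. t ^ i \<partial>\<mu>) = m i 0" for i
  proof -
    define c where "c t = (min 1 (max 0 t)) ^ i" for t :: real
    have c_cont: "isCont c t" for t
      unfolding c_def by (intro continuous_intros)
    have c_bound: "\<bar>c t\<bar> \<le> 1" for t
      unfolding c_def by (auto simp: power_le_one)
    have "(\<integral>t. c t \<partial>\<nu> n) = (\<Sum>k\<le>n. (real k / real n) ^ i * (real (n choose k) * m (0 + k) (n - k)))" for n
    proof -
      have "min 1 (max 0 (real k / real n)) = real k / real n" if "k \<le> n" for k
        using nat_fraction_le_1[OF that] by simp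
      then show ?thesis
        by (subst integral[OF cont_borel[OF c_cont]]) (auto simp: c_def w_def ac_simps intro!: sum.cong)
    qed
    then have "(\<lambda>n. \<integral>t. c t \<partial>\<nu> n) \<longlonglongrightarrow> m i 0"
      using bernstein_moment_tendsto[of m i 0, OF nonneg rec] by simp
    then have "(\<lambda>n. \<integral>t. c t \<partial>\<nu> (r n)) \<longlonglongrightarrow> m i 0"
      using r by (rule LIMSEQ_subseq_LIMSEQ[unfolded o_def])
    then have "(\<integral>t. c t \<partial>\<mu>) = m i 0"
      by (rule LIMSEQ_unique[OF lim[OF c_cont c_bound]])
    moreover have "(\<integral>t. c t \<partial>\<mu>) = (\<integral>t. t ^ i \<partial>\<mu>)"
      using cont_borel[OF c_cont] AE
      by (intro integral_cong_AE) (auto simp: c_def min_def max_def elim: eventually_mono)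
    ultimately show ?thesis by simp
  qed
  with \<mu> AE show ?thesis
    by (intro exI[of _ \<mu>] conjI allI)
qed

section \<open>The real inner product of a complex Hilbert space\<close>

text \<open>The real part of the inner product determines the inner product of a complex space, and as a real bilinear
form it fits the real-linear operators of the type \<^typ>\<open>'a \<Rightarrow>\<^sub>L 'a\<close>.\<close>

definition rinner :: "'a::complex_hilbert_space \<Rightarrow> 'a \<Rightarrow> real" where
  "rinner x y = Re (cinner x y)"

lemma rinner_commute: "rinner x y = rinner y x"
  unfolding rinner_def by (subst cinner_commute) simp

lemma norm_power2_eq_rinner: "(norm x)\<^sup>2 = rinner x x"
proof -
  have "0 \<le> sqrt (rinner x x)"
    using norm_ge_zero[of x] by (simp only: norm_eq_sqrt_cinner rinner_def)
  then show ?thesis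
    by (simp add: norm_eq_sqrt_cinner rinner_def)
qed

lemma rinner_add_right: "rinner x (y + z) = rinner x y + rinner x z"
  by (simp add: rinner_def cinner_add_right)

lemma rinner_scaleR_right: "rinner x (r *\<^sub>R y) = r * rinner x y"
  unfolding rinner_def scaleC_of_real[symmetric] cinner_scaleC_right by simp

lemma rinner_add_left: "rinner (x + y) z = rinner x z + rinner y z"
  using rinner_add_right rinner_commute by metis

lemma rinner_scaleR_left: "rinner (r *\<^sub>R x) y = r * rinner x y"
  using rinner_scaleR_right rinner_commute by metis

text \<open>Half of the Cauchy-Schwarz inequality; it is the triangle inequality for \<open>x + y\<close>, squared.\<close>

lemma rinner_le_norm: "rinner x y \<le> norm x * norm y"
proof -
  have "(norm (x + y))\<^sup>2 \<le> (norm x + norm y)\<^sup>2"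
    by (intro power_mono norm_triangle_ineq) simp
  moreover have "(norm (x + y))\<^sup>2 = (norm x)\<^sup>2 + 2 * rinner x y + (norm y)\<^sup>2"
    by (simp add: norm_power2_eq_rinner rinner_add_left rinner_add_right rinner_commute[of y x])
  ultimately show ?thesis
    by (simp add: power2_sum)
qed

lemma abs_rinner_le_norm: "\<bar>rinner x y\<bar> \<le> norm x * norm y"
  using rinner_le_norm[of x y] rinner_le_norm[of "- x" y] rinner_scaleR_left[of "-1" x y]
  by simp

interpretation rinner: bounded_bilinear rinner
proof
  show "\<exists>K. \<forall>a b. norm (rinner a b) \<le> norm a * norm b * K"
    by (intro exI[of _ 1]) (simp add: abs_rinner_le_norm)
qed (simp_all add: rinner_add_left rinner_add_right rinner_scaleR_left rinner_scaleR_right)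

lemma Im_cinner: "Im (cinner x y) = - rinner x (\<i> *\<^sub>C y)"
  by (simp add: rinner_def cinner_scaleC_right)

lemma rinner_i_left: "rinner (\<i> *\<^sub>C x) y = - rinner x (\<i> *\<^sub>C y)"
proof -
  have "rinner (\<i> *\<^sub>C x) y = Re (\<i> * cinner y x)"
    by (subst rinner_commute) (simp add: rinner_def cinner_scaleC_right)
  also have "\<dots> = Re (\<i> * cnj (cinner x y))"
    by (subst cinner_commute) simp
  finally show ?thesis
    by (simp add: rinner_def cinner_scaleC_right)
qed

lemma bounded_linear_scaleC: "bounded_linear (\<lambda>x::'a::complex_hilbert_space. c *\<^sub>C x)"
proof (rule bounded_linear_intro)
  show "c *\<^sub>C (r *\<^sub>R x) = r *\<^sub>R (c *\<^sub>C x)" for r and x :: 'a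
    by (simp only: scaleC_of_real[symmetric] scaleC_scaleC mult.commute)
  show "norm (c *\<^sub>C x) \<le> norm x * cmod c" for x :: 'a
    by (simp add: norm_scaleC)
qed (rule scaleC_add_right)

text \<open>The imaginary part of the inner product is a real part after multiplication by \<open>\<i>\<close>, which complex-linear
operators respect.\<close>

lemma self_adjoint_iff_rinner:
  "self_adjoint S \<longleftrightarrow> S \<in> bounded_ops \<and> (\<forall>x y. rinner (S x) y = rinner x (S y))"
proof -
  have "cinner (S x) y = cinner x (S y)"
    if "S \<in> bounded_ops" "\<forall>x y. rinner (S x) y = rinner x (S y)" for x y
    using that by (intro complex_eqI) (auto simp: Im_cinner bounded_ops_def simp flip: rinner_def)
  then show ?thesis
    by (auto simp: self_adjoint_def rinner_def)
qed

section \<open>Spectral measures of a bounded positive operator\<close>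

lemma funpow_commute:
  assumes "\<And>x. f (g x) = g (f x)"
  shows "(f ^^ i) ((g ^^ j) x) = (g ^^ j) ((f ^^ i) x)"
proof -
  have "f ((g ^^ j) x) = (g ^^ j) (f x)" for x
    by (induction j) (simp_all add: assms)
  then show ?thesis
    by (induction i) simp_all
qed

text \<open>Two commuting positive operators \<open>a\<close> and \<open>b\<close> with \<open>a + b = M\<close> have nonnegative mixed moments.
By symmetry an exponent can be lowered by 2 at the price of replacing \<open>x\<close> by \<open>a x\<close> or
\<open>b x\<close>, which leaves exponents 0 and 1. The product \<open>a b\<close> itself is positive because
\<open>M a b = a b a + b a b\<close>.\<close>

lemma symmetric_pair_moments:
  fixes a b :: "'a::complex_hilbert_space \<Rightarrow> 'a"
  assumes M: "0 < M"
    and sum: "\<And>x. a x + b x = M *\<^sub>R x"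
    and sym: "\<And>x y. rinner (a x) y = rinner x (a y)" "\<And>x y. rinner (b x) y = rinner x (b y)"
    and comm: "\<And>x. a (b x) = b (a x)"
    and pos: "\<And>x. 0 \<le> rinner x (a x)" "\<And>x. 0 \<le> rinner x (b x)"
  defines "m \<equiv> \<lambda>x i j. rinner x ((a ^^ i) ((b ^^ j) x))"
  shows "M * m x i j = m x (Suc i) j + m x i (Suc j)" (is ?rec)
    and "0 \<le> m x i j" (is ?nonneg)
proof -
  have rec: "M * m x i j = m x (Suc i) j + m x i (Suc j)" for x i j
  proof -
    have ab: "(a ^^ i) ((b ^^ j) (b y)) = b ((a ^^ i) ((b ^^ j) y))" for i j y
      using funpow_commute[of a b, OF comm, of i "Suc j" y] funpow_commute[of a b, OF comm, of i j y]
      by (simp add: funpow_swap1)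
    have "(a ^^ Suc i) ((b ^^ j) x) + (a ^^ i) ((b ^^ Suc j) x)
        = a ((a ^^ i) ((b ^^ j) x)) + b ((a ^^ i) ((b ^^ j) x))"
      using ab by (simp add: funpow_swap1)
    then show ?thesis
      unfolding m_def by (simp add: sum rinner.add_right[symmetric] rinner_scaleR_right)
  qed
  have a2: "m x (Suc (Suc i)) j = m (a x) i j" for x i j
  proof -
    have "(a ^^ Suc (Suc i)) ((b ^^ j) x) = a ((a ^^ i) (a ((b ^^ j) x)))"
      by (simp add: funpow_swap1)
    moreover have "a ((b ^^ j) x) = (b ^^ j) (a x)"
      using funpow_commute[of a b, OF comm, of 1 j x] by simp
    ultimately show ?thesis
      unfolding m_def by (simp add: sym(1))
  qed
  have b2: "m x i (Suc (Suc j)) = m (b x) i j" for x i j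
  proof -
    have "(a ^^ i) ((b ^^ Suc (Suc j)) x) = (a ^^ i) (b ((b ^^ j) (b x)))"
      by (simp add: funpow_swap1)
    moreover have "(a ^^ i) (b y) = b ((a ^^ i) y)" for y
      using funpow_commute[of a b, OF comm, of i 1] by simp
    ultimately have "(a ^^ i) ((b ^^ Suc (Suc j)) x) = b ((a ^^ i) ((b ^^ j) (b x)))"
      by simp
    then show ?thesis
      unfolding m_def by (simp add: sym(2))
  qed
  have base: "0 \<le> m x 0 0" "0 \<le> m x (Suc 0) 0" "0 \<le> m x 0 (Suc 0)" for x
    using pos by (simp_all add: m_def norm_power2_eq_rinner[symmetric])
  have "0 \<le> m x (Suc 0) (Suc 0)" for x
  proof -
    have "M * m x (Suc 0) (Suc 0) = m (a x) 0 (Suc 0) + m (b x) (Suc 0) 0"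
      using rec[of x "Suc 0" "Suc 0"] by (simp add: a2 b2)
    then show ?thesis
      using base(2,3) M by (metis add_nonneg_nonneg zero_le_mult_iff order_less_le not_le)
  qed
  then have "0 \<le> m x 0 j \<and> 0 \<le> m x (Suc 0) j" for x j
    by (induction j arbitrary: x rule: induct_nat_012) (auto simp: base b2)
  then have "0 \<le> m x i j" for x i j
    by (induction i arbitrary: x rule: induct_nat_012) (auto simp: a2)
  then show ?rec ?nonneg
    using rec by blast+
qed

locale bounded_positive_operator =
  fixes A :: "'a::complex_hilbert_space \<Rightarrow>\<^sub>L 'a" and M :: real
  assumes self_adjoint_A: "self_adjoint A"
    and M_pos: "0 < M"
    and A_nonneg: "0 \<le> rinner x (A x)"
    and A_le: "rinner x (A x) \<le> M * (norm x)\<^sup>2"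
begin

lemma A_symmetric: "rinner (A x) y = rinner x (A y)"
  using self_adjoint_A by (simp add: self_adjoint_iff_rinner)

text \<open>Hausdorff's theorem for the mixed moments of \<open>A\<close> and \<open>M - A\<close>, rescaled from \<open>[0, 1]\<close> to
\<open>[0, M]\<close> and from total mass 1 to \<open>\<parallel>x\<parallel>\<^sup>2\<close>.\<close>

lemma spectral_measure_exists:
  "\<exists>\<mu>. finite_measure \<mu> \<and> sets \<mu> = sets borel \<and> (AE t in \<mu>. t \<in> {0..M})
     \<and> (\<forall>i. (\<integral>t. t ^ i \<partial>\<mu>) = rinner x ((blinfun_apply A ^^ i) x))"
proof (cases "x = 0")
  case True
  have "rinner x ((blinfun_apply A ^^ i) x) = 0" for i
    using True by (simp add: rinner.zero_left)
  then show ?thesis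
    by (intro exI[of _ "null_measure borel"]) (auto intro!: finite_measureI AE_I[of _ _ UNIV])
next
  case False
  define b where "b x = M *\<^sub>R x - A x" for x
  define m where "m i j = rinner x ((blinfun_apply A ^^ i) ((b ^^ j) x))" for i j
  have m: "M * m i j = m (Suc i) j + m i (Suc j)" "0 \<le> m i j" for i j
    unfolding m_def
    by (rule symmetric_pair_moments[where M = M and a = "blinfun_apply A" and b = b];
        use M_pos A_le A_nonneg A_symmetric in
        \<open>simp add: b_def rinner.diff_left rinner.diff_right rinner_scaleR_left rinner_scaleR_right
          norm_power2_eq_rinner blinfun.bilinear_simps\<close>)+
  define m' where "m' i j = m i j / (M ^ (i + j) * (norm x)\<^sup>2)" for i j
  have "\<exists>\<nu>. real_distribution \<nu> \<and> (AE t in \<nu>. t \<in> {0..1}) \<and> (\<forall>i. (\<integral>t. t ^ i \<partial>\<nu>) = m' i 0)"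
  proof (rule hausdorff_moment_probability)
    show "0 \<le> m' i j" for i j
      using m(2) M_pos by (simp add: m'_def)
    show "m' i j = m' (Suc i) j + m' i (Suc j)" for i j
      using m(1)[of i j] M_pos False by (simp add: m'_def add_divide_distrib[symmetric]) (simp add: field_simps)
    show "m' 0 0 = 1"
      using False by (simp add: m'_def m_def norm_power2_eq_rinner[symmetric])
  qed
  then obtain \<nu> where \<nu>: "real_distribution \<nu>" and AE: "AE t in \<nu>. t \<in> {0..1}"
    and moments: "\<And>i. (\<integral>t. t ^ i \<partial>\<nu>) = m' i 0"
    by blast
  interpret \<nu>: real_distribution \<nu> by (rule \<nu>)
  define \<mu> where "\<mu> = density (distr \<nu> borel (\<lambda>t. M * t)) (\<lambda>_. (norm x)\<^sup>2)"
  have "finite_measure \<mu>"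
    unfolding \<mu>_def by (rule finite_measureI) (simp add: emeasure_density emeasure_distr ennreal_mult_eq_top_iff \<nu>.emeasure_eq_measure)
  moreover have "sets \<mu> = sets borel"
    by (simp add: \<mu>_def)
  moreover have "AE t in \<mu>. t \<in> {0..M}"
  proof -
    have "AE t in \<nu>. M * t \<in> {0..M}"
      using AE by eventually_elim (use M_pos in auto)
    then show ?thesis
      unfolding \<mu>_def by (simp add: AE_density AE_distr_iff)
  qed
  moreover have "(\<integral>t. t ^ i \<partial>\<mu>) = rinner x ((blinfun_apply A ^^ i) x)" for i
  proof -
    have "(\<integral>t. t ^ i \<partial>\<mu>) = (norm x)\<^sup>2 * M ^ i * (\<integral>t. t ^ i \<partial>\<nu>)"
      unfolding \<mu>_def by (subst integral_density) (auto simp: integral_distr power_mult_distrib)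
    also have "\<dots> = m i 0"
      using False M_pos by (simp add: moments m'_def)
    finally show ?thesis by (simp add: m_def)
  qed
  ultimately show ?thesis by blast
qed

definition spectral_measure :: "'a \<Rightarrow> real measure" where
  "spectral_measure x = (SOME \<mu>. finite_measure \<mu> \<and> sets \<mu> = sets borel \<and> (AE t in \<mu>. t \<in> {0..M})
     \<and> (\<forall>i. (\<integral>t. t ^ i \<partial>\<mu>) = rinner x ((blinfun_apply A ^^ i) x)))"

lemma
  finite_spectral_measure: "finite_measure (spectral_measure x)" and
  sets_spectral_measure [measurable_cong]: "sets (spectral_measure x) = sets borel" and
  AE_spectral_measure: "AE t in spectral_measure x. t \<in> {0..M}" and
  moments_spectral_measure: "(\<integral>t. t ^ i \<partial>spectral_measure x) = rinner x ((blinfun_apply A ^^ i) x)"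
  using someI_ex[OF spectral_measure_exists[of x]] unfolding spectral_measure_def by auto

end

section \<open>Polynomials in the operator and their norms in the square-integrable functions\<close>

lemma power2_add_le: "(a + b)\<^sup>2 \<le> 2 * a\<^sup>2 + 2 * (b :: real)\<^sup>2"
  using zero_le_power2[of "a - b"] by (simp add: power2_eq_square algebra_simps)

context bounded_positive_operator
begin

text \<open>The graph of \<open>p \<mapsto> p(A)\<close>, with polynomials taken as functions. A relation avoids choosing
coefficients, and its rules match the recursion of moments.\<close>

inductive polynomial_operator :: "(real \<Rightarrow> real) \<Rightarrow> ('a \<Rightarrow>\<^sub>L 'a) \<Rightarrow> bool" where
  one: "polynomial_operator (\<lambda>t. 1) id_blinfun"
| times: "polynomial_operator p S \<Longrightarrow> polynomial_operator (\<lambda>t. t * p t) (A o\<^sub>L S)"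
| add: "polynomial_operator p S \<Longrightarrow> polynomial_operator q T \<Longrightarrow> polynomial_operator (\<lambda>t. p t + q t) (S + T)"
| scale: "polynomial_operator p S \<Longrightarrow> polynomial_operator (\<lambda>t. c * p t) (c *\<^sub>R S)"

text \<open>The domain of the calculus on the interval. Boundedness is required on \<open>[0, M]\<close> only, so that
polynomials belong to it.\<close>

definition admissible :: "(real \<Rightarrow> real) \<Rightarrow> bool" where
  "admissible f \<longleftrightarrow> f \<in> borel_measurable borel \<and> (\<exists>C. \<forall>t\<in>{0..M}. \<bar>f t\<bar> \<le> C)"

lemma admissible_measurable: "admissible f \<Longrightarrow> f \<in> borel_measurable borel"
  by (simp add: admissible_def)

lemma admissible_bound:
  assumes "admissible f"
  shows "\<exists>C>0. \<forall>t\<in>{0..M}. \<bar>f t\<bar> \<le> C"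
proof -
  obtain C where "\<forall>t\<in>{0..M}. \<bar>f t\<bar> \<le> C"
    using assms by (auto simp: admissible_def)
  then show ?thesis
    by (intro exI[of _ "max C 1"]) (simp add: le_max_iff_disj)
qed

lemma admissible_bounded:
  "f \<in> borel_measurable borel \<Longrightarrow> (\<And>t. t \<in> {0..M} \<Longrightarrow> \<bar>f t\<bar> \<le> C) \<Longrightarrow> admissible f"
  unfolding admissible_def by blast

lemma admissible_const: "admissible (\<lambda>t. c)"
  by (rule admissible_bounded[where C = "\<bar>c\<bar>"]) auto

lemma admissible_ident: "admissible (\<lambda>t. t)"
  by (rule admissible_bounded[where C = M]) auto

lemma admissible_add:
  assumes "admissible f" "admissible g"
  shows "admissible (\<lambda>t. f t + g t)"
proof -
  obtain C where "0 < C" "\<forall>t\<in>{0..M}. \<bar>f t\<bar> \<le> C"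
    using admissible_bound[OF assms(1)] by blast
  moreover obtain D where "0 < D" "\<forall>t\<in>{0..M}. \<bar>g t\<bar> \<le> D"
    using admissible_bound[OF assms(2)] by blast
  ultimately show ?thesis
    using assms[THEN admissible_measurable]
    by (intro admissible_bounded[where C = "C + D"]) (auto intro: order_trans[OF abs_triangle_ineq add_mono])
qed

lemma admissible_mult:
  assumes "admissible f" "admissible g"
  shows "admissible (\<lambda>t. f t * g t)"
proof -
  obtain C where "0 < C" "\<forall>t\<in>{0..M}. \<bar>f t\<bar> \<le> C"
    using admissible_bound[OF assms(1)] by blast
  moreover obtain D where "0 < D" "\<forall>t\<in>{0..M}. \<bar>g t\<bar> \<le> D"
    using admissible_bound[OF assms(2)] by blast
  ultimately show ?thesis
    using assms[THEN admissible_measurable]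
    by (intro admissible_bounded[where C = "C * D"]) (auto simp: abs_mult intro!: mult_mono)
qed

lemma admissible_diff:
  assumes "admissible f" "admissible g"
  shows "admissible (\<lambda>t. f t - g t)"
  using admissible_add[OF assms(1) admissible_mult[OF admissible_const[of "-1"] assms(2)]] by simp

lemma admissible_power2: "admissible f \<Longrightarrow> admissible (\<lambda>t. (f t)\<^sup>2)"
  unfolding power2_eq_square by (rule admissible_mult)

lemma admissible_power: "admissible (\<lambda>t. t ^ i)"
  by (induction i) (auto intro: admissible_const admissible_mult admissible_ident)

lemmas admissible_intros = admissible_add admissible_diff admissible_mult admissible_power2
  admissible_power admissible_ident admissible_const

lemma integrable_admissible:
  assumes "admissible f"
  shows "integrable (spectral_measure x) f"
proof -
  obtain C where "0 < C" "\<forall>t\<in>{0..M}. \<bar>f t\<bar> \<le> C"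
    using admissible_bound[OF assms] by blast
  then show ?thesis
    using assms AE_spectral_measure[of x]
    by (intro finite_measure.integrable_const_bound[OF finite_spectral_measure, where B = C])
       (auto simp: admissible_def measurable_cong_sets[OF sets_spectral_measure refl] elim: eventually_mono)
qed

lemma integral_spectral_measure_mono:
  assumes "admissible f" "admissible g" "\<And>t. t \<in> {0..M} \<Longrightarrow> f t \<le> g t"
  shows "(\<integral>t. f t \<partial>spectral_measure x) \<le> (\<integral>t. g t \<partial>spectral_measure x)"
  using assms AE_spectral_measure[of x] by (intro integral_mono_AE integrable_admissible) (auto elim: eventually_mono)

lemma integral_spectral_measure_const: "(\<integral>t. c \<partial>spectral_measure x) = c * (norm x)\<^sup>2"
  using moments_spectral_measure[of x 0] by (simp add: norm_power2_eq_rinner)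

text \<open>The squared distance in \<open>L\<^sup>2\<close> of the spectral measure of \<open>x\<close>. The square avoids Minkowski's
inequality: a triangle inequality with a factor 2 is sufficient for all limits.\<close>

definition sq_dist :: "'a \<Rightarrow> (real \<Rightarrow> real) \<Rightarrow> (real \<Rightarrow> real) \<Rightarrow> real" where
  "sq_dist x f g = (\<integral>t. (f t - g t)\<^sup>2 \<partial>spectral_measure x)"

lemma sq_dist_nonneg: "0 \<le> sq_dist x f g"
  unfolding sq_dist_def by simp

lemma sq_dist_commute: "sq_dist x f g = sq_dist x g f"
  unfolding sq_dist_def by (simp add: power2_commute)

lemma sq_dist_add_le:
  assumes "admissible f" "admissible g" "admissible p" "admissible q"
  shows "sq_dist x (\<lambda>t. f t + g t) (\<lambda>t. p t + q t) \<le> 2 * sq_dist x f p + 2 * sq_dist x g q"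
proof -
  have "(\<integral>t. ((f t + g t) - (p t + q t))\<^sup>2 \<partial>spectral_measure x)
      \<le> (\<integral>t. 2 * (f t - p t)\<^sup>2 + 2 * (g t - q t)\<^sup>2 \<partial>spectral_measure x)"
    using assms power2_add_le[of "f t - p t" "g t - q t" for t]
    by (intro integral_spectral_measure_mono admissible_intros) (auto simp: algebra_simps)
  also have "\<dots> = 2 * sq_dist x f p + 2 * sq_dist x g q"
    unfolding sq_dist_def using assms
    by (subst Bochner_Integration.integral_add) (auto intro!: integrable_admissible admissible_intros)
  finally show ?thesis unfolding sq_dist_def .
qed

lemma sq_dist_triangle:
  assumes "admissible f" "admissible g" "admissible h"
  shows "sq_dist x f h \<le> 2 * sq_dist x f g + 2 * sq_dist x g h"
  using sq_dist_add_le[OF assms(1) assms(2) assms(2) assms(3), of x]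
  by (simp add: sq_dist_def add.commute)

lemma sq_dist_mult_le:
  assumes "admissible f" "admissible g" "admissible h" "\<And>t. t \<in> {0..M} \<Longrightarrow> \<bar>h t\<bar> \<le> C"
  shows "sq_dist x (\<lambda>t. h t * f t) (\<lambda>t. h t * g t) \<le> C\<^sup>2 * sq_dist x f g"
proof -
  have "(\<integral>t. (h t * f t - h t * g t)\<^sup>2 \<partial>spectral_measure x)
      \<le> (\<integral>t. C\<^sup>2 * (f t - g t)\<^sup>2 \<partial>spectral_measure x)"
  proof (intro integral_spectral_measure_mono)
    fix t assume "t \<in> {0..M}"
    then have "(h t)\<^sup>2 \<le> C\<^sup>2"
      using assms(4) power_mono[of "\<bar>h t\<bar>" C 2] by simp
    then show "(h t * f t - h t * g t)\<^sup>2 \<le> C\<^sup>2 * (f t - g t)\<^sup>2"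
      by (simp only: right_diff_distrib[symmetric] power_mult_distrib) (intro mult_right_mono, auto)
  qed (intro admissible_intros assms)+
  then show ?thesis by (simp add: sq_dist_def)
qed

lemma sq_dist_tendsto_0:
  assumes f: "admissible f" and F: "\<And>n. admissible (F n)"
    and bound: "\<And>n t. t \<in> {0..M} \<Longrightarrow> \<bar>F n t\<bar> \<le> C"
    and lim: "\<And>t. t \<in> {0..M} \<Longrightarrow> (\<lambda>n. F n t) \<longlonglongrightarrow> f t"
  shows "(\<lambda>n. sq_dist x f (F n)) \<longlonglongrightarrow> 0"
proof -
  obtain D where D: "\<forall>t\<in>{0..M}. \<bar>f t\<bar> \<le> D"
    using admissible_bound[OF f] by blast
  have "(\<lambda>n. \<integral>t. (f t - F n t)\<^sup>2 \<partial>spectral_measure x) \<longlonglongrightarrow> (\<integral>t. 0 \<partial>spectral_measure x)"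
  proof (rule integral_dominated_convergence[where w = "\<lambda>t. (C + D)\<^sup>2"])
    show "(\<lambda>t. (f t - F n t)\<^sup>2) \<in> borel_measurable (spectral_measure x)" for n
      using integrable_admissible[of "\<lambda>t. (f t - F n t)\<^sup>2" x] f F
      by (intro borel_measurable_integrable integrable_admissible admissible_intros)
    show "AE t in spectral_measure x. (\<lambda>n. (f t - F n t)\<^sup>2) \<longlonglongrightarrow> 0"
      using AE_spectral_measure[of x]
    proof eventually_elim
      case (elim t)
      have "(\<lambda>n. (f t - F n t)\<^sup>2) \<longlonglongrightarrow> (f t - f t)\<^sup>2"
        using lim[OF elim] by (intro tendsto_intros)
      then show ?case by simp
    qed
    show "AE t in spectral_measure x. norm ((f t - F n t)\<^sup>2) \<le> (C + D)\<^sup>2" for n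
      using AE_spectral_measure[of x]
    proof eventually_elim
      case (elim t)
      have "\<bar>f t - F n t\<bar> \<le> C + D"
        using bound[OF elim, of n] bspec[OF D elim] by linarith
      then have "\<bar>f t - F n t\<bar>\<^sup>2 \<le> (C + D)\<^sup>2"
        by (intro power_mono) auto
      then show ?case by simp
    qed
  qed (auto intro: integrable_admissible admissible_const)
  then show ?thesis by (simp add: sq_dist_def)
qed

lemma polynomial_operator_admissible: "polynomial_operator p S \<Longrightarrow> admissible p"
  by (induction rule: polynomial_operator.induct) (auto intro: admissible_intros)

lemma polynomial_operator_commute: "polynomial_operator p S \<Longrightarrow> S (A x) = A (S x)"
  by (induction arbitrary: x rule: polynomial_operator.induct)
     (auto simp: blinfun.bilinear_simps)

lemma polynomial_operator_scaleC: "polynomial_operator p S \<Longrightarrow> S (c *\<^sub>C x) = c *\<^sub>C S x"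
proof (induction arbitrary: x rule: polynomial_operator.induct)
  case (times p S)
  then show ?case
    using self_adjoint_A by (simp add: self_adjoint_def bounded_ops_def)
next
  case (add p S q T)
  then show ?case by (simp add: blinfun.bilinear_simps scaleC_add_right)
next
  case (scale p S r)
  have "r *\<^sub>R (c *\<^sub>C S x) = c *\<^sub>C (r *\<^sub>R S x)"
    by (simp only: scaleC_of_real[symmetric] scaleC_scaleC mult.commute)
  with scale show ?case by (simp add: blinfun.bilinear_simps)
qed simp

lemma polynomial_operator_symmetric: "polynomial_operator p S \<Longrightarrow> rinner (S x) y = rinner x (S y)"
  by (induction arbitrary: x y rule: polynomial_operator.induct)
     (auto simp: blinfun.bilinear_simps rinner.add_left rinner.add_right rinner_scaleR_left
       rinner_scaleR_right A_symmetric polynomial_operator_commute)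

lemma polynomial_operator_integral:
  "polynomial_operator p S \<Longrightarrow>
    rinner x ((blinfun_apply A ^^ i) (S x)) = (\<integral>t. t ^ i * p t \<partial>spectral_measure x)"
proof (induction arbitrary: i rule: polynomial_operator.induct)
  case one
  then show ?case by (simp add: moments_spectral_measure)
next
  case (times p S)
  then show ?case
    using times.IH[of "Suc i"] by (simp add: funpow_swap1 ac_simps)
next
  case (add p S q T)
  have lin: "(blinfun_apply A ^^ i) (y + z) = (blinfun_apply A ^^ i) y + (blinfun_apply A ^^ i) z" for y z
    by (induction i) (simp_all add: blinfun.bilinear_simps)
  have "admissible (\<lambda>t. t ^ i * p t)" "admissible (\<lambda>t. t ^ i * q t)"
    using add.hyps by (auto intro: admissible_intros dest: polynomial_operator_admissible)
  then show ?case
    using add.IH by (simp add: lin blinfun.bilinear_simps rinner.add_right distrib_left integrable_admissible)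
next
  case (scale p S c)
  have lin: "(blinfun_apply A ^^ i) (c *\<^sub>R y) = c *\<^sub>R (blinfun_apply A ^^ i) y" for y
    by (induction i) (simp_all add: blinfun.bilinear_simps)
  have "(\<integral>t. t ^ i * (c * p t) \<partial>spectral_measure x) = c * (\<integral>t. t ^ i * p t \<partial>spectral_measure x)"
    by (simp only: mult.left_commute integral_mult_right_zero)
  with scale.IH show ?case
    by (simp add: lin blinfun.bilinear_simps rinner_scaleR_right)
qed

lemma polynomial_operator_mult:
  assumes "polynomial_operator p S" "polynomial_operator q T"
  shows "polynomial_operator (\<lambda>t. p t * q t) (S o\<^sub>L T)"
  using assms(1)
proof (induction rule: polynomial_operator.induct)
  case one
  have "id_blinfun o\<^sub>L T = T" by (rule blinfun_eqI) simp
  with assms(2) show ?case by simp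
next
  case (times p S)
  have "polynomial_operator (\<lambda>t. t * (p t * q t)) (A o\<^sub>L (S o\<^sub>L T))"
    by (rule polynomial_operator.times[OF times.IH])
  moreover have "A o\<^sub>L (S o\<^sub>L T) = (A o\<^sub>L S) o\<^sub>L T" by (rule blinfun_eqI) simp
  ultimately show ?case by (simp add: ac_simps)
next
  case (add p S p' S')
  then have "polynomial_operator (\<lambda>t. p t * q t + p' t * q t) ((S o\<^sub>L T) + (S' o\<^sub>L T))"
    by (intro polynomial_operator.add)
  moreover have "(S o\<^sub>L T) + (S' o\<^sub>L T) = (S + S') o\<^sub>L T"
    by (rule blinfun_eqI) (simp add: blinfun.bilinear_simps)
  ultimately show ?case by (simp add: distrib_right)
next
  case (scale p S c)
  then have "polynomial_operator (\<lambda>t. c * (p t * q t)) (c *\<^sub>R (S o\<^sub>L T))"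
    by (intro polynomial_operator.scale)
  moreover have "c *\<^sub>R (S o\<^sub>L T) = (c *\<^sub>R S) o\<^sub>L T"
    by (rule blinfun_eqI) (simp add: blinfun.bilinear_simps)
  ultimately show ?case by (simp add: ac_simps)
qed

lemma polynomial_operator_diff:
  assumes "polynomial_operator p S" "polynomial_operator q T"
  shows "polynomial_operator (\<lambda>t. p t - q t) (S - T)"
  using polynomial_operator.add[OF assms(1) polynomial_operator.scale[OF assms(2), of "-1"]] by simp

text \<open>The isometry on which the calculus rests: \<open>p(A)\<close> is symmetric, so the left hand side is
\<open>\<langle>x, p(A)\<^sup>2 x\<rangle>\<close>.\<close>

lemma norm_polynomial_operator:
  assumes "polynomial_operator p S"
  shows "(norm (S x))\<^sup>2 = (\<integral>t. (p t)\<^sup>2 \<partial>spectral_measure x)"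
  using polynomial_operator_integral[OF polynomial_operator_mult[OF assms assms], of x 0]
    polynomial_operator_symmetric[OF assms, of x "S x"]
  unfolding norm_power2_eq_rinner by (simp add: power2_eq_square)

lemma norm_diff_polynomial_operator:
  assumes "polynomial_operator p S" "polynomial_operator q T"
  shows "(norm (S x - T x))\<^sup>2 = sq_dist x p q"
  using norm_polynomial_operator[OF polynomial_operator_diff[OF assms], of x]
  by (simp add: sq_dist_def blinfun.bilinear_simps)

lemma polynomial_operator_const: "polynomial_operator (\<lambda>t. c) (c *\<^sub>R id_blinfun)"
  using polynomial_operator.scale[OF polynomial_operator.one, of c] by simp

lemma polynomial_operator_exists:
  fixes g :: "real \<Rightarrow> real"
  assumes "real_polynomial_function g"
  shows "\<exists>S. polynomial_operator g S"
  using assms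
proof (induction rule: real_polynomial_function.induct)
  case (linear f)
  have "f t = f 1 * (t * 1)" for t
    using linear_scale[OF bounded_linear.linear[OF linear], of t 1] by simp
  then have "f = (\<lambda>t. f 1 * (t * 1))" by (rule ext)
  moreover have "\<exists>S. polynomial_operator (\<lambda>t. f 1 * (t * 1)) S"
    by (rule exI polynomial_operator.scale polynomial_operator.times polynomial_operator.one)+
  ultimately show ?case by simp
next
  case (const c)
  then show ?case by (rule exI) (rule polynomial_operator_const)
next
  case (add f g)
  then show ?case by (elim exE) (rule exI, rule polynomial_operator.add)
next
  case (mult f g)
  then show ?case by (elim exE) (rule exI, rule polynomial_operator_mult)
qed

end

section \<open>Density of the polynomials\<close>

context bounded_positive_operator
begin

text \<open>Approximation in the spaces of several vectors simultaneously is what makes the calculus linear in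
\<open>x\<close> and multiplicative.\<close>

definition approximable :: "(real \<Rightarrow> real) \<Rightarrow> bool" where
  "approximable f \<longleftrightarrow> admissible f \<and>
    (\<forall>V e. finite V \<longrightarrow> 0 < e \<longrightarrow> (\<exists>p S. polynomial_operator p S \<and> (\<forall>x\<in>V. sq_dist x f p < e)))"

lemma approximable_admissible: "approximable f \<Longrightarrow> admissible f"
  by (simp add: approximable_def)

lemma approximable_polynomial:
  assumes "polynomial_operator p S"
  shows "approximable p"
  unfolding approximable_def
proof (intro conjI allI impI)
  show "\<exists>q S. polynomial_operator q S \<and> (\<forall>x\<in>V. sq_dist x p q < e)" if "0 < e" for V and e :: real
    using assms that by (intro exI[of _ p] exI[of _ S]) (simp add: sq_dist_def)
qed (rule polynomial_operator_admissible[OF assms])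

text \<open>Dominated convergence reduces the limit to one member of the sequence, uniformly over the finitely many
vectors.\<close>

lemma approximable_limit:
  assumes f: "f \<in> borel_measurable borel" and F: "\<And>n. approximable (F n)"
    and bound: "\<And>n t. t \<in> {0..M} \<Longrightarrow> \<bar>F n t\<bar> \<le> C"
    and lim: "\<And>t. t \<in> {0..M} \<Longrightarrow> (\<lambda>n. F n t) \<longlonglongrightarrow> f t"
  shows "approximable f"
  unfolding approximable_def
proof (intro conjI allI impI)
  have F': "admissible (F n)" for n
    by (rule approximable_admissible[OF F])
  show adm: "admissible f"
  proof (rule admissible_bounded[OF f, of C])
    fix t assume t: "t \<in> {0..M}"
    show "\<bar>f t\<bar> \<le> C"
      using tendsto_rabs[OF lim[OF t]] bound[OF t] by (intro LIMSEQ_le_const2) auto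
  qed
  fix V :: "'a set" and e :: real assume V: "finite V" and e: "0 < e"
  then have e4: "0 < e / 4" by simp
  have "\<forall>x\<in>V. eventually (\<lambda>n. sq_dist x f (F n) < e / 4) sequentially"
    using e4 by (intro ballI order_tendstoD(2)[OF sq_dist_tendsto_0[OF adm F' bound lim]])
  then have "eventually (\<lambda>n. \<forall>x\<in>V. sq_dist x f (F n) < e / 4) sequentially"
    using V by (simp add: eventually_ball_finite)
  then obtain n where n: "\<forall>x\<in>V. sq_dist x f (F n) < e / 4"
    using eventually_happens' sequentially_bot by blast
  obtain p S where p: "polynomial_operator p S" "\<forall>x\<in>V. sq_dist x (F n) p < e / 4"
    using F[of n] V e4 unfolding approximable_def by blast
  have "sq_dist x f p < e" if "x \<in> V" for x
    using sq_dist_triangle[OF adm F'[of n] polynomial_operator_admissible[OF p(1)], of x]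
      n p(2) that by fastforce
  then show "\<exists>p S. polynomial_operator p S \<and> (\<forall>x\<in>V. sq_dist x f p < e)"
    using p(1) by blast
qed

lemma approximable_cong:
  assumes "approximable g" "f \<in> borel_measurable borel" "\<And>t. t \<in> {0..M} \<Longrightarrow> f t = g t"
  shows "approximable f"
proof -
  obtain C where C: "\<forall>t\<in>{0..M}. \<bar>g t\<bar> \<le> C"
    using admissible_bound[OF approximable_admissible[OF assms(1)]] by blast
  show ?thesis
    by (rule approximable_limit[where F = "\<lambda>n. g" and C = C]) (use assms C in auto)
qed

lemma approximable_add:
  assumes "approximable f" "approximable g"
  shows "approximable (\<lambda>t. f t + g t)"
  unfolding approximable_def
proof (intro conjI allI impI)
  have adm: "admissible f" "admissible g"
    using assms by (auto intro: approximable_admissible)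
  then show "admissible (\<lambda>t. f t + g t)"
    by (rule admissible_add)
  fix V :: "'a set" and e :: real assume V: "finite V" and e: "0 < e"
  then have e4: "0 < e / 4" by simp
  obtain p S where p: "polynomial_operator p S" "\<forall>x\<in>V. sq_dist x f p < e / 4"
    using assms(1) V e4 unfolding approximable_def by blast
  obtain q T where q: "polynomial_operator q T" "\<forall>x\<in>V. sq_dist x g q < e / 4"
    using assms(2) V e4 unfolding approximable_def by blast
  have "sq_dist x (\<lambda>t. f t + g t) (\<lambda>t. p t + q t) < e" if "x \<in> V" for x
    using sq_dist_add_le[OF adm polynomial_operator_admissible[OF p(1)] polynomial_operator_admissible[OF q(1)], of x]
      p(2) q(2) that by fastforce
  then show "\<exists>p S. polynomial_operator p S \<and> (\<forall>x\<in>V. sq_dist x (\<lambda>t. f t + g t) p < e)"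
    using polynomial_operator.add[OF p(1) q(1)]
    by (intro exI[of _ "\<lambda>t. p t + q t"] exI[of _ "S + T"] conjI ballI)
qed

lemma sq_dist_scale: "sq_dist x (\<lambda>t. c * f t) (\<lambda>t. c * g t) = c\<^sup>2 * sq_dist x f g"
proof -
  have "(c * f t - c * g t)\<^sup>2 = c\<^sup>2 * (f t - g t)\<^sup>2" for t
    by (simp only: right_diff_distrib[symmetric] power_mult_distrib)
  then show ?thesis
    by (simp add: sq_dist_def)
qed

lemma approximable_scale:
  assumes "approximable f"
  shows "approximable (\<lambda>t. c * f t)"
  unfolding approximable_def
proof (intro conjI allI impI)
  have adm: "admissible f"
    using assms by (auto intro: approximable_admissible)
  then show "admissible (\<lambda>t. c * f t)"
    by (intro admissible_intros)
  fix V :: "'a set" and e :: real assume V: "finite V" and e: "0 < e"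
  then have e': "0 < e / (c\<^sup>2 + 1)"
    by (simp add: add_nonneg_pos)
  obtain p S where p: "polynomial_operator p S" "\<forall>x\<in>V. sq_dist x f p < e / (c\<^sup>2 + 1)"
    using assms(1) V e' unfolding approximable_def by blast
  have "sq_dist x (\<lambda>t. c * f t) (\<lambda>t. c * p t) < e" if "x \<in> V" for x
  proof -
    have "c\<^sup>2 * sq_dist x f p \<le> (c\<^sup>2 + 1) * sq_dist x f p"
      by (intro mult_right_mono) (auto simp: sq_dist_nonneg)
    also have "\<dots> < e"
      using p(2) that by (simp add: pos_less_divide_eq add_nonneg_pos mult.commute)
    finally show ?thesis by (simp add: sq_dist_scale)
  qed
  then show "\<exists>p S. polynomial_operator p S \<and> (\<forall>x\<in>V. sq_dist x (\<lambda>t. c * f t) p < e)"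
    using polynomial_operator.scale[OF p(1)]
    by (intro exI[of _ "\<lambda>t. c * p t"] exI[of _ "c *\<^sub>R S"] conjI ballI)
qed

lemma approximable_const: "approximable (\<lambda>t. c)"
  by (rule approximable_polynomial[OF polynomial_operator_const])

lemma approximable_sum:
  "(\<And>i. i < n \<Longrightarrow> approximable (f i)) \<Longrightarrow> approximable (\<lambda>t. \<Sum>i<n. f i t)" for n :: nat
  by (induction n) (simp_all add: approximable_const approximable_add)

lemma approximable_continuous:
  assumes "continuous_on UNIV f"
  shows "approximable f"
proof -
  have "\<exists>p. approximable p \<and> (\<forall>t\<in>{0..M}. \<bar>f t - p t\<bar> < 1 / real (Suc n))" for n
  proof -
    obtain p where p: "real_polynomial_function p" "\<And>t. t \<in> {0..M} \<Longrightarrow> \<bar>f t - p t\<bar> < 1 / real (Suc n)"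
      using Stone_Weierstrass_real_polynomial_function[of "{0..M}" f "1 / real (Suc n)"]
        continuous_on_subset[OF assms subset_UNIV] by auto
    then show ?thesis
      using polynomial_operator_exists[OF p(1)] by (intro exI[of _ p]) (auto intro: approximable_polynomial)
  qed
  then have "\<forall>n. \<exists>p. approximable p \<and> (\<forall>t\<in>{0..M}. \<bar>f t - p t\<bar> < 1 / real (Suc n))"
    by (rule allI)
  from choice[OF this] obtain p where
    p: "\<And>n. approximable (p n)" "\<And>n t. t \<in> {0..M} \<Longrightarrow> \<bar>f t - p n t\<bar> < 1 / real (Suc n)"
    by blast
  have "bounded (f ` {0..M})"
    using assms by (intro compact_imp_bounded compact_continuous_image) (auto intro: continuous_on_subset)
  then obtain C where C: "\<forall>t\<in>{0..M}. \<bar>f t\<bar> \<le> C"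
    by (auto simp: bounded_iff)
  show ?thesis
  proof (rule approximable_limit[OF _ p(1), where f = f and C = "C + 1"])
    show "f \<in> borel_measurable borel"
      using assms by (rule borel_measurable_continuous_onI)
    fix t assume t: "t \<in> {0..M}"
    have "1 / real (Suc n) \<le> 1" for n by simp
    then have "\<bar>f t - p n t\<bar> \<le> 1" for n
      using order.strict_trans2[OF p(2)[OF t, of n]] by (simp add: less_imp_le)
    then show "\<bar>p n t\<bar> \<le> C + 1" for n
      using bspec[OF C t] \<open>\<bar>f t - p n t\<bar> \<le> 1\<close> by linarith
    have "(\<lambda>n. f t - p n t) \<longlonglongrightarrow> 0"
    proof (rule Lim_null_comparison)
      show "\<forall>\<^sub>F n in sequentially. norm (f t - p n t) \<le> 1 / real (Suc n)"
        using p(2)[OF t] by (intro always_eventually allI) (simp add: less_imp_le)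
      show "(\<lambda>n. 1 / real (Suc n)) \<longlonglongrightarrow> 0"
        using LIMSEQ_Suc[OF lim_1_over_n] .
    qed
    then show "(\<lambda>n. p n t) \<longlonglongrightarrow> f t"
      using tendsto_diff[OF tendsto_const[of "f t"], of "\<lambda>n. f t - p n t" 0 sequentially] by simp
  qed
qed

lemma approximable_indicator_atMost: "approximable (indicator {..a})"
proof (rule approximable_limit)
  let ?F = "\<lambda>n t. min 1 (max 0 (1 - real n * (t - a)))"
  show "approximable (?F n)" for n
    by (intro approximable_continuous continuous_intros)
  show "\<bar>?F n t\<bar> \<le> 1" for n t
    by auto
  show "(\<lambda>n. ?F n t) \<longlonglongrightarrow> indicator {..a} t" for t
  proof (cases "t \<le> a")
    case True
    have clamp: "min 1 (max 0 (1 - s)) = 1" if "s \<le> 0" for s :: real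
      using that by simp
    have "?F n t = 1" for n
      by (rule clamp) (use True in \<open>simp add: mult_nonneg_nonpos\<close>)
    then show ?thesis using True by simp
  next
    case False
    obtain N where N: "1 / (t - a) < real N"
      using reals_Archimedean2 by blast
    have "?F n t = 0" if "N \<le> n" for n
    proof -
      have "1 / (t - a) \<le> real n"
        using N that by (meson less_imp_le of_nat_le_iff order_trans)
      then have "1 \<le> real n * (t - a)"
        using False by (simp add: pos_divide_le_eq)
      then show ?thesis by simp
    qed
    then have "(\<lambda>n. ?F n t) \<longlonglongrightarrow> 0"
      by (intro tendsto_eventually eventually_sequentiallyI[of N])
    then show ?thesis using False by simp
  qed
qed simp

text \<open>The half-lines generate the Borel sets and are stable under intersection, so Dynkin's theorem
applies; complements and countable disjoint unions are covered by linearity and by bounded limits.\<close>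

lemma approximable_indicator:
  assumes "B \<in> sets borel"
  shows "approximable (indicator B)"
proof -
  let ?G = "range (\<lambda>a::real. {..a})"
  have "Int_stable ?G" "?G \<subseteq> Pow UNIV"
    by (auto simp: Int_stable_def)
  moreover have borel: "sigma_sets UNIV ?G = sets borel"
    by (simp add: borel_eq_atMost)
  then have "B \<in> sigma_sets UNIV ?G"
    using assms by simp
  ultimately show ?thesis
  proof (induction rule: sigma_sets_induct_disjoint)
    case (basic B)
    then show ?case using approximable_indicator_atMost by auto
  next
    case empty
    show ?case using approximable_const[of 0] by (simp add: indicator_def[abs_def])
  next
    case (compl B)
    have "approximable (\<lambda>t. 1 + (-1) * indicator B t)"
      by (intro approximable_add approximable_const approximable_scale compl.IH)
    moreover have "indicator (UNIV - B) = (\<lambda>t. 1 + (-1) * indicator B t :: real)"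
      by (auto simp: indicator_def)
    ultimately show ?case by simp
  next
    case (union B)
    have initial: "approximable (indicator (\<Union>i<n. B i))" for n :: nat
    proof -
      have "indicator (\<Union>i<n. B i) = (\<lambda>t. \<Sum>i<n. indicator (B i) t :: real)"
        using union.hyps(1) by (intro ext indicator_UN_disjoint) (auto intro: disjoint_family_on_mono)
      then show ?thesis
        using approximable_sum[of n "\<lambda>i. indicator (B i)"] union.IH by simp
    qed
    have "(\<Union>i. B i) \<in> sets borel"
      using union.hyps(2) borel by auto
    then show ?case
      by (intro approximable_limit[where F = "\<lambda>n. indicator (\<Union>i<n. B i)" and C = 1, OF _ initial])
        (auto simp: LIMSEQ_indicator_UN)
  qed
qed

lemma approximable_nonneg_bounded:
  assumes "u \<in> borel_measurable borel" "\<And>t. 0 \<le> u t" "\<And>t. u t \<le> C"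
  shows "approximable u"
  using assms
proof (induction arbitrary: C rule: borel_measurable_induct_real)
  case (set B)
  then show ?case by (simp add: approximable_indicator)
next
  case (mult u c)
  show ?case
  proof (cases "c = 0")
    case True
    then show ?thesis using approximable_const[of 0] by simp
  next
    case False
    then have "u t \<le> C / c" for t
      using mult.prems[of t] mult.hyps(1) by (simp add: pos_le_divide_eq mult.commute)
    then show ?thesis
      by (intro approximable_scale mult.IH)
  qed
next
  case (add u v)
  have "u t \<le> C" "v t \<le> C" for t
    using add.prems[of t] add.hyps(2)[of t] add.hyps(4)[of t] by linarith+
  then show ?case
    by (intro approximable_add add.IH)
next
  case (seq U)
  have U: "U i t \<le> u t" for i t
    using seq.hyps(3,4) by (intro incseq_le) (auto simp: incseq_def le_fun_def)
  have bounded: "U i t \<le> C" for i t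
    using U[of i t] seq.prems[of t] by linarith
  show ?case
  proof (rule approximable_limit)
    show "\<bar>U i t\<bar> \<le> C" for i t
      using bounded[of i t] seq.hyps(2)[of i t] by simp
    show "u \<in> borel_measurable borel"
      by (rule borel_measurable_LIMSEQ_real[OF seq.hyps(4) seq.hyps(1)])
    show "approximable (U i)" for i
      by (rule seq.IH[OF bounded])
    show "(\<lambda>i. U i t) \<longlonglongrightarrow> u t" for t
      by (rule seq.hyps(4)) simp
  qed
qed

lemma admissible_approximable:
  assumes "admissible f"
  shows "approximable f"
proof -
  obtain C where C: "\<forall>t\<in>{0..M}. \<bar>f t\<bar> \<le> C"
    using admissible_bound[OF assms] by blast
  have f[measurable]: "f \<in> borel_measurable borel"
    by (rule admissible_measurable[OF assms])
  let ?g = "\<lambda>t. if t \<in> {0..M} then f t + C else 0"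
  have "approximable ?g"
  proof (rule approximable_nonneg_bounded)
    show "0 \<le> ?g t" "?g t \<le> 2 * \<bar>C\<bar>" for t
      using C by (auto simp: abs_le_iff dest!: bspec[of _ _ t])
  qed measurable
  then have "approximable (\<lambda>t. ?g t + (- C))"
    by (intro approximable_add approximable_const)
  then show ?thesis
    by (rule approximable_cong) (use f in auto)
qed

lemma polynomial_approximation_seq:
  assumes "admissible f" "finite V"
  obtains p S where "\<And>n. polynomial_operator (p n) (S n)"
    "\<And>x. x \<in> V \<Longrightarrow> (\<lambda>n. sq_dist x f (p n)) \<longlonglongrightarrow> 0"
proof -
  have "\<exists>p S. polynomial_operator p S \<and> (\<forall>x\<in>V. sq_dist x f p < 1 / real (Suc n))" for n
    using admissible_approximable[OF assms(1)] assms(2) unfolding approximable_def by simp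
  then have "\<forall>n. \<exists>pS. polynomial_operator (fst pS) (snd pS) \<and> (\<forall>x\<in>V. sq_dist x f (fst pS) < 1 / real (Suc n))"
    by simp
  from choice[OF this] obtain pS where
    "\<forall>n. polynomial_operator (fst (pS n)) (snd (pS n)) \<and> (\<forall>x\<in>V. sq_dist x f (fst (pS n)) < 1 / real (Suc n))" ..
  moreover define p S where "p n = fst (pS n)" and "S n = snd (pS n)" for n
  ultimately have p: "\<And>n. polynomial_operator (p n) (S n)"
    "\<And>n x. x \<in> V \<Longrightarrow> sq_dist x f (p n) < 1 / real (Suc n)"
    by simp_all
  have "(\<lambda>n. sq_dist x f (p n)) \<longlonglongrightarrow> 0" if "x \<in> V" for x
  proof (rule Lim_null_comparison)
    show "\<forall>\<^sub>F n in sequentially. norm (sq_dist x f (p n)) \<le> 1 / real (Suc n)"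
      using p(2)[OF that] by (intro always_eventually allI) (simp add: sq_dist_nonneg less_imp_le)
    show "(\<lambda>n. 1 / real (Suc n)) \<longlonglongrightarrow> 0"
      using LIMSEQ_Suc[OF lim_1_over_n] .
  qed
  with p(1) show thesis by (rule that)
qed

end

section \<open>The calculus for bounded Borel functions on an interval\<close>

lemma tendsto_0_le:
  fixes a b :: "nat \<Rightarrow> real"
  assumes "\<And>n. 0 \<le> a n" "\<And>n. a n \<le> b n" "b \<longlonglongrightarrow> 0"
  shows "a \<longlonglongrightarrow> 0"
  by (rule Lim_null_comparison[OF _ assms(3)]) (simp add: assms(1,2))

context bounded_positive_operator
begin

lemma sq_dist_zero_le:
  assumes "admissible f" "\<And>t. t \<in> {0..M} \<Longrightarrow> \<bar>f t\<bar> \<le> C"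
  shows "sq_dist x f (\<lambda>t. 0) \<le> C\<^sup>2 * (norm x)\<^sup>2"
proof -
  have "(\<integral>t. (f t - 0)\<^sup>2 \<partial>spectral_measure x) \<le> (\<integral>t. C\<^sup>2 \<partial>spectral_measure x)"
  proof (rule integral_spectral_measure_mono)
    fix t assume "t \<in> {0..M}"
    then show "(f t - 0)\<^sup>2 \<le> C\<^sup>2"
      using power_mono[of "\<bar>f t\<bar>" C 2] assms(2) by simp
  qed (intro admissible_intros assms)+
  then show ?thesis
    by (simp only: sq_dist_def integral_spectral_measure_const)
qed

lemma polynomial_operator_zero: "polynomial_operator (\<lambda>t. 0) 0"
  using polynomial_operator_const[of 0] by simp

text \<open>The extension of the isometry by completeness. The inequality is an equality without the factor 2,
but this form follows from the weak triangle inequality and determines \<open>v\<close>, because the right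
hand side can be made arbitrarily small.\<close>

lemma calculus_vector_exists:
  assumes f: "admissible f"
  shows "\<exists>v. \<forall>p S. polynomial_operator p S \<longrightarrow> (norm (v - S x))\<^sup>2 \<le> 2 * sq_dist x f p"
proof -
  obtain p S where p: "\<And>n. polynomial_operator (p n) (S n)" and lim: "(\<lambda>n. sq_dist x f (p n)) \<longlonglongrightarrow> 0"
    using polynomial_approximation_seq[OF f, of "{x}"] by auto
  have p': "admissible (p n)" for n
    by (rule polynomial_operator_admissible[OF p])
  have bound: "(norm (S n x - T x))\<^sup>2 \<le> 2 * sq_dist x f (p n) + 2 * sq_dist x f q"
    if "polynomial_operator q T" for n q T
    using sq_dist_triangle[OF p'[of n] f polynomial_operator_admissible[OF that], of x]
    by (simp add: norm_diff_polynomial_operator[OF p that] sq_dist_commute)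
  have "Cauchy (\<lambda>n. S n x)"
  proof (rule CauchyI)
    fix e :: real assume e: "0 < e"
    then have "\<forall>\<^sub>F n in sequentially. sq_dist x f (p n) < e\<^sup>2 / 4"
      by (intro order_tendstoD(2)[OF lim]) simp
    then obtain N where N: "\<And>n. N \<le> n \<Longrightarrow> sq_dist x f (p n) < e\<^sup>2 / 4"
      by (auto simp: eventually_sequentially)
    show "\<exists>N. \<forall>m\<ge>N. \<forall>n\<ge>N. norm (S m x - S n x) < e"
    proof (intro exI[of _ N] allI impI)
      fix m n assume "N \<le> m" "N \<le> n"
      then have "(norm (S m x - S n x))\<^sup>2 < e\<^sup>2"
        using bound[OF p, of m n] N[of m] N[of n] by linarith
      then show "norm (S m x - S n x) < e"
        using e by (simp add: power2_less_imp_less)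
    qed
  qed
  then obtain v where v: "(\<lambda>n. S n x) \<longlonglongrightarrow> v"
    using Cauchy_convergent_iff convergent_def by blast
  have "(norm (v - T x))\<^sup>2 \<le> 2 * sq_dist x f q" if "polynomial_operator q T" for q T
  proof -
    have "(norm (v - T x))\<^sup>2 \<le> 2 * 0 + 2 * sq_dist x f q"
    proof (rule LIMSEQ_le)
      show "(\<lambda>n. (norm (S n x - T x))\<^sup>2) \<longlonglongrightarrow> (norm (v - T x))\<^sup>2"
        by (intro tendsto_intros v)
      show "(\<lambda>n. 2 * sq_dist x f (p n) + 2 * sq_dist x f q) \<longlonglongrightarrow> 2 * 0 + 2 * sq_dist x f q"
        by (intro tendsto_intros lim)
    qed (use bound[OF that] in auto)
    then show ?thesis by simp
  qed
  then show ?thesis by blast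
qed

definition calculus_vector :: "(real \<Rightarrow> real) \<Rightarrow> 'a \<Rightarrow> 'a" where
  "calculus_vector f x =
    (SOME v. \<forall>p S. polynomial_operator p S \<longrightarrow> (norm (v - S x))\<^sup>2 \<le> 2 * sq_dist x f p)"

lemma calculus_vector_dist:
  assumes "admissible f" "polynomial_operator p S"
  shows "(norm (calculus_vector f x - S x))\<^sup>2 \<le> 2 * sq_dist x f p"
  using someI_ex[OF calculus_vector_exists[OF assms(1), of x]] assms(2)
  unfolding calculus_vector_def by blast

lemma calculus_vector_tendsto:
  assumes "admissible f" "\<And>n. polynomial_operator (p n) (S n)" "(\<lambda>n. sq_dist x f (p n)) \<longlonglongrightarrow> 0"
  shows "(\<lambda>n. S n x) \<longlonglongrightarrow> calculus_vector f x"
proof -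
  have "(\<lambda>n. sqrt (2 * sq_dist x f (p n))) \<longlonglongrightarrow> sqrt (2 * 0)"
    by (intro tendsto_intros assms)
  then have lim: "(\<lambda>n. sqrt (2 * sq_dist x f (p n))) \<longlonglongrightarrow> 0" by simp
  have "norm (S n x - calculus_vector f x) \<le> sqrt (2 * sq_dist x f (p n))" for n
    using calculus_vector_dist[OF assms(1) assms(2)[of n], of x]
    by (intro real_le_rsqrt) (simp add: norm_minus_commute)
  then have "(\<lambda>n. S n x - calculus_vector f x) \<longlonglongrightarrow> 0"
    by (intro Lim_null_comparison[OF _ lim]) simp
  then show ?thesis
    by (simp add: LIM_zero_iff)
qed

lemma calculus_vector_bound:
  assumes "admissible f" "\<And>t. t \<in> {0..M} \<Longrightarrow> \<bar>f t\<bar> \<le> C" "0 \<le> C"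
  shows "norm (calculus_vector f x) \<le> sqrt 2 * C * norm x"
proof (rule power2_le_imp_le)
  have "(norm (calculus_vector f x))\<^sup>2 \<le> 2 * sq_dist x f (\<lambda>t. 0)"
    using calculus_vector_dist[OF assms(1) polynomial_operator_zero, of x] by simp
  also have "\<dots> \<le> 2 * (C\<^sup>2 * (norm x)\<^sup>2)"
    using sq_dist_zero_le[OF assms(1,2), of x] by simp
  finally show "(norm (calculus_vector f x))\<^sup>2 \<le> (sqrt 2 * C * norm x)\<^sup>2"
    by (simp add: power_mult_distrib)
qed (use assms in simp)

lemma calculus_vector_scaleC:
  assumes "admissible f"
  shows "calculus_vector f (c *\<^sub>C x) = c *\<^sub>C calculus_vector f x"
proof -
  obtain p S where p: "\<And>n. polynomial_operator (p n) (S n)"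
    and lim: "\<And>y. y \<in> {x, c *\<^sub>C x} \<Longrightarrow> (\<lambda>n. sq_dist y f (p n)) \<longlonglongrightarrow> 0"
    using polynomial_approximation_seq[OF assms, of "{x, c *\<^sub>C x}"] by blast
  have "(\<lambda>n. c *\<^sub>C S n x) \<longlonglongrightarrow> c *\<^sub>C calculus_vector f x"
    using bounded_linear.tendsto[OF bounded_linear_scaleC calculus_vector_tendsto[where p = p and S = S, OF assms p lim]] by simp
  moreover have "(\<lambda>n. S n (c *\<^sub>C x)) \<longlonglongrightarrow> calculus_vector f (c *\<^sub>C x)"
    by (rule calculus_vector_tendsto[where p = p and S = S, OF assms p lim]) simp
  ultimately show ?thesis
    by (simp add: polynomial_operator_scaleC[OF p] LIMSEQ_unique)
qed

lemma calculus_vector_add_right: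
  assumes "admissible f"
  shows "calculus_vector f (x + y) = calculus_vector f x + calculus_vector f y"
proof -
  obtain p S where p: "\<And>n. polynomial_operator (p n) (S n)"
    and lim: "\<And>z. z \<in> {x, y, x + y} \<Longrightarrow> (\<lambda>n. sq_dist z f (p n)) \<longlonglongrightarrow> 0"
    using polynomial_approximation_seq[OF assms, of "{x, y, x + y}"] by blast
  have "(\<lambda>n. S n x + S n y) \<longlonglongrightarrow> calculus_vector f x + calculus_vector f y"
    by (intro tendsto_add calculus_vector_tendsto[where p = p and S = S, OF assms p lim]) simp_all
  moreover have "(\<lambda>n. S n (x + y)) \<longlonglongrightarrow> calculus_vector f (x + y)"
    by (rule calculus_vector_tendsto[where p = p and S = S, OF assms p lim]) simp
  ultimately show ?thesis
    by (simp add: blinfun.add_right LIMSEQ_unique)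
qed

lemma bounded_linear_calculus_vector:
  assumes "admissible f"
  shows "bounded_linear (calculus_vector f)"
proof -
  obtain C where "0 < C" "\<forall>t\<in>{0..M}. \<bar>f t\<bar> \<le> C"
    using admissible_bound[OF assms] by blast
  then have "norm (calculus_vector f x) \<le> norm x * (sqrt 2 * C)" for x
    using calculus_vector_bound[OF assms, of C x] by (simp add: ac_simps)
  moreover have "calculus_vector f (r *\<^sub>R x) = r *\<^sub>R calculus_vector f x" for r x
    using calculus_vector_scaleC[OF assms, of "complex_of_real r" x] by (simp add: scaleC_of_real)
  ultimately show ?thesis
    by (intro bounded_linear_intro calculus_vector_add_right assms)
qed

definition calculus :: "(real \<Rightarrow> real) \<Rightarrow> ('a \<Rightarrow>\<^sub>L 'a)" where
  "calculus f = Blinfun (calculus_vector f)"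

lemma calculus_apply: "admissible f \<Longrightarrow> calculus f x = calculus_vector f x"
  by (simp add: calculus_def bounded_linear_Blinfun_apply bounded_linear_calculus_vector)

lemma calculus_tendsto:
  assumes "admissible f" "\<And>n. polynomial_operator (p n) (S n)" "(\<lambda>n. sq_dist x f (p n)) \<longlonglongrightarrow> 0"
  shows "(\<lambda>n. S n x) \<longlonglongrightarrow> calculus f x"
  using calculus_vector_tendsto[where p = p and S = S, OF assms] by (simp add: calculus_apply assms(1))

text \<open>Most laws of the calculus are transferred from polynomials through this criterion.\<close>

lemma calculus_eqI:
  assumes "admissible f" "\<And>n. polynomial_operator (p n) (S n)" "(\<lambda>n. sq_dist x f (p n)) \<longlonglongrightarrow> 0"
    and "(\<lambda>n. S n x) \<longlonglongrightarrow> v"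
  shows "calculus f x = v"
  using calculus_tendsto[where p = p and S = S, OF assms(1-3)] assms(4) by (rule LIMSEQ_unique)

lemma norm_calculus_le:
  assumes "admissible f" "\<And>t. t \<in> {0..M} \<Longrightarrow> \<bar>f t\<bar> \<le> C" "0 \<le> C"
  shows "norm (calculus f x) \<le> sqrt 2 * C * norm x"
  using calculus_vector_bound[OF assms] by (simp add: calculus_apply assms(1))

lemma norm_calculus_le_sq_dist:
  assumes "admissible f"
  shows "(norm (calculus f x))\<^sup>2 \<le> 2 * sq_dist x f (\<lambda>t. 0)"
  using calculus_vector_dist[OF assms polynomial_operator_zero, of x]
  by (simp add: calculus_apply assms)

lemma calculus_scaleC: "admissible f \<Longrightarrow> calculus f (c *\<^sub>C x) = c *\<^sub>C calculus f x"
  by (simp add: calculus_apply calculus_vector_scaleC)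

lemma calculus_symmetric:
  assumes "admissible f"
  shows "rinner (calculus f x) y = rinner x (calculus f y)"
proof -
  obtain p S where p: "\<And>n. polynomial_operator (p n) (S n)"
    and lim: "\<And>z. z \<in> {x, y} \<Longrightarrow> (\<lambda>n. sq_dist z f (p n)) \<longlonglongrightarrow> 0"
    using polynomial_approximation_seq[OF assms, of "{x, y}"] by blast
  have "(\<lambda>n. rinner (S n x) y) \<longlonglongrightarrow> rinner (calculus f x) y"
    by (intro rinner.tendsto tendsto_const calculus_tendsto[where p = p and S = S, OF assms p lim]) simp
  moreover have "(\<lambda>n. rinner x (S n y)) \<longlonglongrightarrow> rinner x (calculus f y)"
    by (intro rinner.tendsto tendsto_const calculus_tendsto[where p = p and S = S, OF assms p lim]) simp
  ultimately show ?thesis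
    by (simp add: polynomial_operator_symmetric[OF p] LIMSEQ_unique)
qed

lemma self_adjoint_calculus: "admissible f \<Longrightarrow> self_adjoint (calculus f)"
  by (simp add: self_adjoint_iff_rinner bounded_ops_def calculus_scaleC calculus_symmetric)

lemma calculus_polynomial:
  assumes "polynomial_operator p S"
  shows "calculus p = S"
proof (rule blinfun_eqI)
  show "calculus p x = S x" for x
    by (rule calculus_eqI[where p = "\<lambda>_. p" and S = "\<lambda>_. S"])
      (simp_all add: assms polynomial_operator_admissible[OF assms] sq_dist_def)
qed

lemma calculus_const: "calculus (\<lambda>t. c) = c *\<^sub>R id_blinfun"
  by (rule calculus_polynomial[OF polynomial_operator_const])

lemma calculus_ident: "calculus (\<lambda>t. t) = A"
proof -
  have "A o\<^sub>L id_blinfun = A" by (rule blinfun_eqI) simp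
  then show ?thesis
    using calculus_polynomial[OF polynomial_operator.times[OF polynomial_operator.one]]
    by (simp only: mult_1_right)
qed

lemma calculus_cong:
  assumes "admissible f" "admissible g" "\<And>t. t \<in> {0..M} \<Longrightarrow> f t = g t"
  shows "calculus f = calculus g"
proof (rule blinfun_eqI)
  fix x
  obtain p S where p: "\<And>n. polynomial_operator (p n) (S n)"
    and lim: "(\<lambda>n. sq_dist x g (p n)) \<longlonglongrightarrow> 0"
    using polynomial_approximation_seq[OF assms(2), of "{x}"] by auto
  have "sq_dist x f (p n) \<le> sq_dist x g (p n)" for n
    unfolding sq_dist_def
  proof (rule integral_spectral_measure_mono)
    show "(f t - p n t)\<^sup>2 \<le> (g t - p n t)\<^sup>2" if "t \<in> {0..M}" for t
      by (simp only: assms(3)[OF that] order_refl)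
  qed (intro admissible_power2 admissible_diff assms(1,2) polynomial_operator_admissible[OF p])+
  then have "(\<lambda>n. sq_dist x f (p n)) \<longlonglongrightarrow> 0"
    by (intro tendsto_0_le[OF sq_dist_nonneg _ lim]) simp
  then show "calculus f x = calculus g x"
    by (rule calculus_eqI[where p = p and S = S, OF assms(1) p _ calculus_tendsto[where p = p and S = S, OF assms(2) p lim]])
qed

lemma calculus_add:
  assumes "admissible f" "admissible g"
  shows "calculus (\<lambda>t. f t + g t) = calculus f + calculus g"
proof (rule blinfun_eqI)
  fix x
  obtain p S where p: "\<And>n. polynomial_operator (p n) (S n)"
    and p_lim: "(\<lambda>n. sq_dist x f (p n)) \<longlonglongrightarrow> 0"
    using polynomial_approximation_seq[OF assms(1), of "{x}"] by auto
  obtain q T where q: "\<And>n. polynomial_operator (q n) (T n)"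
    and q_lim: "(\<lambda>n. sq_dist x g (q n)) \<longlonglongrightarrow> 0"
    using polynomial_approximation_seq[OF assms(2), of "{x}"] by auto
  have sum_lim: "(\<lambda>n. 2 * sq_dist x f (p n) + 2 * sq_dist x g (q n)) \<longlonglongrightarrow> 2 * 0 + 2 * 0"
    by (intro tendsto_intros p_lim q_lim)
  have bound: "sq_dist x (\<lambda>t. f t + g t) (\<lambda>t. p n t + q n t) \<le> 2 * sq_dist x f (p n) + 2 * sq_dist x g (q n)" for n
    by (intro sq_dist_add_le assms polynomial_operator_admissible[OF p] polynomial_operator_admissible[OF q])
  have lim: "(\<lambda>n. sq_dist x (\<lambda>t. f t + g t) (\<lambda>t. p n t + q n t)) \<longlonglongrightarrow> 0"
    by (rule tendsto_0_le[OF sq_dist_nonneg bound]) (use sum_lim in simp)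
  have limit: "(\<lambda>n. (S n + T n) x) \<longlonglongrightarrow> calculus f x + calculus g x"
    unfolding blinfun.add_left
    by (intro tendsto_add calculus_tendsto[where p = p and S = S, OF assms(1) p p_lim] calculus_tendsto[where p = q and S = T, OF assms(2) q q_lim])
  show "calculus (\<lambda>t. f t + g t) x = (calculus f + calculus g) x"
    unfolding blinfun.add_left
    by (rule calculus_eqI[where p = "\<lambda>n t. p n t + q n t" and S = "\<lambda>n. S n + T n",
          OF admissible_add[OF assms] polynomial_operator.add[OF p q] lim limit])
qed

lemma calculus_scale:
  assumes "admissible f"
  shows "calculus (\<lambda>t. c * f t) = c *\<^sub>R calculus f"
proof (rule blinfun_eqI)
  fix x
  obtain p S where p: "\<And>n. polynomial_operator (p n) (S n)"
    and lim: "(\<lambda>n. sq_dist x f (p n)) \<longlonglongrightarrow> 0"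
    using polynomial_approximation_seq[OF assms, of "{x}"] by auto
  have "(\<lambda>n. c\<^sup>2 * sq_dist x f (p n)) \<longlonglongrightarrow> c\<^sup>2 * 0"
    by (intro tendsto_intros lim)
  then have lim': "(\<lambda>n. sq_dist x (\<lambda>t. c * f t) (\<lambda>t. c * p n t)) \<longlonglongrightarrow> 0"
    by (simp add: sq_dist_scale)
  have limit: "(\<lambda>n. (c *\<^sub>R S n) x) \<longlonglongrightarrow> c *\<^sub>R calculus f x"
    unfolding blinfun.scaleR_left by (intro tendsto_intros calculus_tendsto[where p = p and S = S, OF assms p lim])
  show "calculus (\<lambda>t. c * f t) x = (c *\<^sub>R calculus f) x"
    unfolding blinfun.scaleR_left
    by (rule calculus_eqI[where p = "\<lambda>n t. c * p n t" and S = "\<lambda>n. c *\<^sub>R S n",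
          OF admissible_mult[OF admissible_const assms] polynomial_operator.scale[OF p] lim' limit])
qed

lemma calculus_diff:
  assumes "admissible f" "admissible g"
  shows "calculus (\<lambda>t. f t - g t) = calculus f - calculus g"
  using calculus_add[OF assms(1) admissible_mult[OF admissible_const[of "-1"] assms(2)]]
  by (simp add: calculus_scale[OF assms(2), of "-1", simplified])

lemma calculus_L2_tendsto:
  assumes "admissible f" "\<And>n. admissible (F n)" "(\<lambda>n. sq_dist x f (F n)) \<longlonglongrightarrow> 0"
  shows "(\<lambda>n. calculus (F n) x) \<longlonglongrightarrow> calculus f x"
proof -
  have "(\<lambda>n. sqrt (2 * sq_dist x f (F n))) \<longlonglongrightarrow> sqrt (2 * 0)"
    by (intro tendsto_intros assms)
  then have lim: "(\<lambda>n. sqrt (2 * sq_dist x f (F n))) \<longlonglongrightarrow> 0" by simp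
  have "norm (calculus (F n) x - calculus f x) \<le> sqrt (2 * sq_dist x f (F n))" for n
  proof (rule real_le_rsqrt)
    have "(norm (calculus (\<lambda>t. f t - F n t) x))\<^sup>2 \<le> 2 * sq_dist x (\<lambda>t. f t - F n t) (\<lambda>t. 0)"
      by (intro norm_calculus_le_sq_dist admissible_intros assms)
    also have "sq_dist x (\<lambda>t. f t - F n t) (\<lambda>t. 0) = sq_dist x f (F n)"
      by (simp add: sq_dist_def)
    finally show "(norm (calculus (F n) x - calculus f x))\<^sup>2 \<le> 2 * sq_dist x f (F n)"
      by (simp add: calculus_diff assms blinfun.diff_left norm_minus_commute)
  qed
  then have "(\<lambda>n. calculus (F n) x - calculus f x) \<longlonglongrightarrow> 0"
    by (intro Lim_null_comparison[OF _ lim]) simp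
  then show ?thesis
    by (simp add: LIM_zero_iff)
qed

lemma calculus_bounded_tendsto:
  assumes "admissible f" "\<And>n. admissible (F n)"
    and "\<And>n t. t \<in> {0..M} \<Longrightarrow> \<bar>F n t\<bar> \<le> C"
    and "\<And>t. t \<in> {0..M} \<Longrightarrow> (\<lambda>n. F n t) \<longlonglongrightarrow> f t"
  shows "(\<lambda>n. calculus (F n) x) \<longlonglongrightarrow> calculus f x"
  by (intro calculus_L2_tendsto sq_dist_tendsto_0[where C = C] assms)

lemma sq_dist_mult_tendsto:
  assumes "admissible f" "\<And>n. admissible (F n)" "admissible h" "(\<lambda>n. sq_dist x f (F n)) \<longlonglongrightarrow> 0"
  shows "(\<lambda>n. sq_dist x (\<lambda>t. h t * f t) (\<lambda>t. h t * F n t)) \<longlonglongrightarrow> 0"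
proof -
  obtain C where C: "\<forall>t\<in>{0..M}. \<bar>h t\<bar> \<le> C"
    using admissible_bound[OF assms(3)] by blast
  have lim: "(\<lambda>n. C\<^sup>2 * sq_dist x f (F n)) \<longlonglongrightarrow> C\<^sup>2 * 0"
    by (intro tendsto_intros assms(4))
  have bound: "sq_dist x (\<lambda>t. h t * f t) (\<lambda>t. h t * F n t) \<le> C\<^sup>2 * sq_dist x f (F n)" for n
    by (rule sq_dist_mult_le[OF assms(1,2,3) bspec[OF C]])
  show ?thesis
    by (rule tendsto_0_le[OF sq_dist_nonneg bound]) (use lim in simp)
qed

text \<open>Here \<open>f\<close> has to be approximated for \<open>x\<close> and for \<open>T x\<close> by the same polynomials.\<close>

lemma calculus_polynomial_mult:
  assumes "admissible f" "polynomial_operator q T"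
  shows "calculus (\<lambda>t. q t * f t) x = calculus f (T x)"
proof -
  have q: "admissible q"
    by (rule polynomial_operator_admissible[OF assms(2)])
  obtain p S where p: "\<And>n. polynomial_operator (p n) (S n)"
    and lim: "\<And>z. z \<in> {x, T x} \<Longrightarrow> (\<lambda>n. sq_dist z f (p n)) \<longlonglongrightarrow> 0"
    using polynomial_approximation_seq[OF assms(1), of "{x, T x}"] by blast
  have "(\<lambda>n. sq_dist x (\<lambda>t. q t * f t) (\<lambda>t. q t * p n t)) \<longlonglongrightarrow> 0"
    by (intro sq_dist_mult_tendsto assms(1) q polynomial_operator_admissible[OF p] lim) simp
  then have "(\<lambda>n. sq_dist x (\<lambda>t. q t * f t) (\<lambda>t. p n t * q t)) \<longlonglongrightarrow> 0"
    by (simp only: mult.commute[of "q _" "p _ _"])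
  moreover have "(\<lambda>n. (S n o\<^sub>L T) x) \<longlonglongrightarrow> calculus f (T x)"
    unfolding blinfun_apply_blinfun_compose by (rule calculus_tendsto[where p = p and S = S, OF assms(1) p lim]) simp
  ultimately show ?thesis
    by (rule calculus_eqI[where p = "\<lambda>n t. p n t * q t" and S = "\<lambda>n. S n o\<^sub>L T",
          OF admissible_mult[OF q assms(1)] polynomial_operator_mult[OF p assms(2)]])
qed

text \<open>With one factor a polynomial this is known; then let polynomials converge to the other factor.\<close>

lemma calculus_mult:
  assumes "admissible f" "admissible g"
  shows "calculus (\<lambda>t. f t * g t) = calculus f o\<^sub>L calculus g"
proof (rule blinfun_eqI)
  fix x
  obtain q T where q: "\<And>n. polynomial_operator (q n) (T n)"
    and lim: "(\<lambda>n. sq_dist x g (q n)) \<longlonglongrightarrow> 0"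
    using polynomial_approximation_seq[OF assms(2), of "{x}"] by auto
  have q': "admissible (q n)" for n
    by (rule polynomial_operator_admissible[OF q])
  have "(\<lambda>n. calculus (\<lambda>t. f t * q n t) x) \<longlonglongrightarrow> calculus (\<lambda>t. f t * g t) x"
    by (intro calculus_L2_tendsto admissible_intros sq_dist_mult_tendsto lim assms q')
  moreover have "calculus (\<lambda>t. f t * q n t) x = calculus f (T n x)" for n
    using calculus_polynomial_mult[OF assms(1) q, of n x] by (simp only: mult.commute)
  moreover have "(\<lambda>n. calculus f (T n x)) \<longlonglongrightarrow> calculus f (calculus g x)"
    by (intro tendsto_intros calculus_tendsto[where p = q and S = T, OF assms(2) q lim])
  ultimately show "calculus (\<lambda>t. f t * g t) x = (calculus f o\<^sub>L calculus g) x"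
    by (simp add: LIMSEQ_unique)
qed

end

section \<open>Concentration of the calculus on the spectrum\<close>

context bounded_positive_operator
begin

text \<open>The points where \<open>A - t\<close> is not bounded below. For a self-adjoint operator this is the whole
spectrum; it is used because it is visibly closed and contained in the spectrum, and because failure of membership
is directly an estimate.\<close>

definition approximate_spectrum :: "real set" where
  "approximate_spectrum = {t. \<forall>e>0. \<exists>y. norm (A y - t *\<^sub>R y) < e * norm y}"

lemma not_approximate_spectrum:
  "t \<notin> approximate_spectrum \<longleftrightarrow> (\<exists>e>0. \<forall>y. e * norm y \<le> norm (A y - t *\<^sub>R y))"
  by (auto simp: approximate_spectrum_def not_less)

lemma scaleC_op_apply: "scaleC_op c S x = c *\<^sub>C S x" for x :: 'a
  by (simp add: scaleC_op.rep_eq)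

lemma approximate_spectrum_subset: "approximate_spectrum \<subseteq> real_spectrum A"
proof
  fix t assume t: "t \<in> approximate_spectrum"
  show "t \<in> real_spectrum A"
  proof (rule ccontr)
    assume "t \<notin> real_spectrum A"
    then obtain B where B: "B o\<^sub>L (A - scaleC_op (complex_of_real t) id_blinfun) = id_blinfun"
      by (auto simp: real_spectrum_def spectrum_def)
    have B': "B (A y - t *\<^sub>R y) = y" for y
      using arg_cong[OF B, of "\<lambda>S. blinfun_apply S y"]
      by (simp add: blinfun.diff_left scaleC_op_apply scaleC_of_real)
    have pos: "0 < 1 / (norm B + 1)"
      by (simp add: add_nonneg_pos)
    then obtain y where y: "norm (A y - t *\<^sub>R y) < 1 / (norm B + 1) * norm y"
      using t unfolding approximate_spectrum_def by blast
    have "norm y \<le> norm B * norm (A y - t *\<^sub>R y)"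
      using norm_blinfun[of B "A y - t *\<^sub>R y"] by (simp add: B')
    also have "\<dots> \<le> (norm B + 1) * norm (A y - t *\<^sub>R y)"
      by (simp add: mult_right_mono)
    also have "\<dots> < (norm B + 1) * (1 / (norm B + 1) * norm y)"
      using y by (intro mult_strict_left_mono) (auto simp: add_nonneg_pos)
    also have "\<dots> = norm y"
      using norm_ge_zero[of B] by (simp add: add_nonneg_eq_0_iff)
    finally show False by simp
  qed
qed

lemma closed_approximate_spectrum: "closed approximate_spectrum"
  unfolding closed_def open_dist
proof (intro ballI)
  fix t assume "t \<in> - approximate_spectrum"
  then obtain e where e: "0 < e" "\<And>y. e * norm y \<le> norm (A y - t *\<^sub>R y)"
    using not_approximate_spectrum[of t] by auto
  have "s \<in> - approximate_spectrum" if s: "dist s t < e / 2" for s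
  proof -
    have "e / 2 * norm y \<le> norm (A y - s *\<^sub>R y)" for y
    proof -
      have "A y - t *\<^sub>R y = (A y - s *\<^sub>R y) + (s - t) *\<^sub>R y"
        by (simp add: algebra_simps)
      then have "norm (A y - t *\<^sub>R y) \<le> norm (A y - s *\<^sub>R y) + \<bar>s - t\<bar> * norm y"
        using norm_triangle_ineq[of "A y - s *\<^sub>R y" "(s - t) *\<^sub>R y"]
        by (simp only: norm_scaleR real_norm_def)
      moreover have "\<bar>s - t\<bar> * norm y \<le> e / 2 * norm y"
        using s by (intro mult_right_mono) (auto simp: dist_real_def)
      ultimately show ?thesis
        using e(2)[of y] by simp
    qed
    note bound = this
    show ?thesis
      unfolding Compl_iff not_approximate_spectrum
      by (intro exI[of _ "e / 2"] conjI allI bound) (use e(1) in simp)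
  qed
  then show "\<exists>e>0. \<forall>s. dist s t < e \<longrightarrow> s \<in> - approximate_spectrum"
    using e(1) by (intro exI[of _ "e / 2"]) auto
qed

lemma admissible_indicator: "B \<in> sets borel \<Longrightarrow> admissible (indicator B)"
  by (rule admissible_bounded[where C = 1]) (auto simp: indicator_def)

lemma calculus_zero: "calculus (\<lambda>t. 0) = 0"
  using calculus_const[of 0] by simp

text \<open>Let \<open>\<parallel>A y - t y\<parallel> \<ge> e \<parallel>y\<parallel>\<close> for all \<open>y\<close>. A vector \<open>y\<close> in the range of the spectral projection of a
small interval around \<open>t\<close> satisfies \<open>A y - t y = ((\<cdot> - t) 1\<^sub>U)(A) y\<close>, which is too short
unless \<open>y = 0\<close>.\<close>

lemma indicator_zero_off_approximate_spectrum:
  assumes "t \<notin> approximate_spectrum"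
  shows "\<exists>U. open U \<and> t \<in> U \<and> calculus (indicator U) = 0"
proof -
  obtain e where e: "0 < e" "\<And>y. e * norm y \<le> norm (A y - t *\<^sub>R y)"
    using assms not_approximate_spectrum[of t] by auto
  \<comment> \<open>The radius absorbs the factor \<open>sqrt 2 \<le> 2\<close> in the norm bound of the calculus.\<close>
  define U where "U = {t - e / 3<..<t + e / 3}"
  have U: "admissible (indicator U)"
    by (rule admissible_indicator) (simp add: U_def)
  have shift: "admissible (\<lambda>s. s - t)" "calculus (\<lambda>s. s - t) = A - t *\<^sub>R id_blinfun"
    by (intro admissible_intros)
      (simp add: calculus_diff[OF admissible_ident admissible_const] calculus_ident calculus_const)
  have idem: "calculus (indicator U) = calculus (indicator U) o\<^sub>L calculus (indicator U)"
  proof -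
    have "indicator U = (\<lambda>s. indicator U s * indicator U s :: real)"
      by (auto simp: indicator_def)
    then show ?thesis
      using calculus_mult[OF U U] by simp
  qed
  have "calculus (indicator U) x = 0" for x
  proof -
    define y where "y = calculus (indicator U) x"
    have Uy: "calculus (indicator U) y = y"
      using arg_cong[OF idem, of "\<lambda>S. blinfun_apply S x"] by (simp add: y_def)
    have "A y - t *\<^sub>R y = calculus (\<lambda>s. (s - t) * indicator U s) y"
      using calculus_mult[OF shift(1) U] by (simp add: shift(2) Uy blinfun.bilinear_simps)
    moreover have "\<bar>(s - t) * indicator U s\<bar> \<le> e / 3" for s
      using e(1) by (simp add: U_def indicator_def abs_if)
    then have "norm (calculus (\<lambda>s. (s - t) * indicator U s) y) \<le> sqrt 2 * (e / 3) * norm y"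
      using e(1) by (intro norm_calculus_le admissible_mult shift(1) U) simp_all
    ultimately have "e * norm y \<le> sqrt 2 * (e / 3) * norm y"
      using e(2)[of y] by simp
    also have "\<dots> \<le> 2 * (e / 3) * norm y"
      using e(1) by (intro mult_right_mono) (auto intro: real_le_lsqrt)
    finally have "e / 3 * norm y \<le> 0"
      by simp
    then show ?thesis
      using e(1) by (simp add: y_def mult_le_0_iff)
  qed
  then show ?thesis
    using e(1) by (intro exI[of _ U]) (auto simp: U_def intro: blinfun_eqI)
qed

text \<open>By Lindelof's theorem countably many of the open null sets cover the complement, and null sets are closed
under countable unions.\<close>

lemma indicator_compl_approximate_spectrum: "calculus (indicator (- approximate_spectrum)) = 0"
proof -
  let ?F = "{U. open U \<and> calculus (indicator U) = 0}"
  obtain F' where F': "F' \<subseteq> ?F" "countable F'" "\<Union>F' = \<Union>?F"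
    using Lindelof[of ?F] by auto
  \<comment> \<open>The empty set makes the family nonempty, so that it can be enumerated.\<close>
  define G where "G = insert {} F'"
  have "calculus (indicator {}) = 0"
    using calculus_zero by (simp add: indicator_def[abs_def])
  then have G: "G \<subseteq> ?F" "countable G" "\<Union>G = \<Union>?F" "G \<noteq> {}"
    using F' by (auto simp: G_def)
  define U where "U = from_nat_into G"
  have U: "open (U i)" "calculus (indicator (U i)) = 0" for i
    using from_nat_into[OF G(4), of i] G(1) by (auto simp: U_def)
  have cover: "(\<Union>i. U i) = \<Union>?F"
    using range_from_nat_into[OF G(4,2)] G(3) by (simp add: U_def)
  have adm: "admissible (indicator V)" if "open V" for V
    using that by (intro admissible_indicator) simp
  have initial: "calculus (indicator (\<Union>i<n. U i)) = 0" for n :: nat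
  proof (induction n)
    case 0
    then show ?case
      using calculus_zero by (simp add: indicator_def[abs_def])
  next
    case (Suc n)
    let ?V = "\<Union>i<n. U i"
    have V: "open ?V"
      using U(1) by auto
    have "indicator (\<Union>i<Suc n. U i)
        = (\<lambda>t. (indicator ?V t + indicator (U n) t) - indicator ?V t * indicator (U n) t :: real)"
      by (auto simp: indicator_def lessThan_Suc)
    then have "calculus (indicator (\<Union>i<Suc n. U i)) = (calculus (indicator ?V) + calculus (indicator (U n)))
        - (calculus (indicator ?V) o\<^sub>L calculus (indicator (U n)))"
      using adm[OF V] adm[OF U(1)[of n]] by (simp only: calculus_diff calculus_add calculus_mult admissible_add admissible_mult)
    then show ?case
      by (simp only: Suc U(2)) (simp add: blinfun_eqI)
  qed
  have "calculus (indicator (\<Union>i. U i)) x = 0" for x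
  proof -
    have "(\<lambda>n. calculus (indicator (\<Union>i<n. U i)) x) \<longlonglongrightarrow> calculus (indicator (\<Union>i. U i)) x"
      using U(1) by (intro calculus_bounded_tendsto[where C = 1] adm LIMSEQ_indicator_UN) auto
    then show ?thesis
      by (simp only: initial) (simp add: LIMSEQ_const_iff)
  qed
  then have null: "calculus (indicator (\<Union>?F)) = 0"
    unfolding cover by (intro blinfun_eqI) simp
  have "- approximate_spectrum \<subseteq> \<Union>?F"
    using indicator_zero_off_approximate_spectrum by blast
  then have split: "indicator (- approximate_spectrum)
      = (\<lambda>t. indicator (- approximate_spectrum) t * indicator (\<Union>?F) t :: real)"
    by (auto simp: indicator_def fun_eq_iff)
  have "open (- approximate_spectrum)" "open (\<Union>?F)"
    using closed_approximate_spectrum by (auto simp: closed_def)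
  then have "calculus (indicator (- approximate_spectrum))
      = calculus (indicator (- approximate_spectrum)) o\<^sub>L calculus (indicator (\<Union>?F))"
    by (subst split) (rule calculus_mult[OF adm adm])
  then show ?thesis
    by (simp add: null blinfun_eqI)
qed

text \<open>Functions in the domain of a Borel calculus are controlled on the spectrum only; cutting them off makes them Borel
functions on the line.\<close>

definition on_spectrum :: "(real \<Rightarrow> real) \<Rightarrow> real \<Rightarrow> real" where
  "on_spectrum f t = (if t \<in> approximate_spectrum then f t else 0)"

lemma admissible_on_spectrum:
  assumes "f \<in> bounded_borel_on (real_spectrum A)"
  shows "admissible (on_spectrum f)"
proof -
  have "f \<in> borel_measurable (restrict_space borel approximate_spectrum)"
    using assms approximate_spectrum_subset
    by (auto simp: bounded_borel_on_def intro: measurable_restrict_mono)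
  then have "on_spectrum f \<in> borel_measurable borel"
    using closed_approximate_spectrum unfolding on_spectrum_def[abs_def]
    by (subst (asm) measurable_restrict_space_iff[where c = 0]) auto
  moreover obtain C where "\<forall>t\<in>real_spectrum A. \<bar>f t\<bar> \<le> C"
    using assms by (auto simp: bounded_borel_on_def bounded_iff)
  then have "\<bar>on_spectrum f t\<bar> \<le> \<bar>C\<bar>" for t
    using approximate_spectrum_subset by (force simp: on_spectrum_def)
  ultimately show ?thesis
    by (rule admissible_bounded)
qed

lemma calculus_on_spectrum:
  assumes "admissible f"
  shows "admissible (on_spectrum f)" "calculus (on_spectrum f) = calculus f"
proof -
  let ?c = "\<lambda>t. 1 - indicator (- approximate_spectrum) t :: real"
  have compl: "admissible (indicator (- approximate_spectrum))"
    using closed_approximate_spectrum by (intro admissible_indicator) auto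
  have "on_spectrum f = (\<lambda>t. f t * ?c t)"
    by (auto simp: on_spectrum_def indicator_def)
  moreover have "admissible ?c"
    by (intro admissible_diff admissible_const compl)
  moreover have "calculus ?c = id_blinfun"
    using calculus_diff[OF admissible_const[of 1] compl] calculus_const[of 1]
    by (simp add: indicator_compl_approximate_spectrum)
  moreover have "calculus f o\<^sub>L id_blinfun = calculus f"
    by (rule blinfun_eqI) simp
  ultimately show "admissible (on_spectrum f)" "calculus (on_spectrum f) = calculus f"
    using calculus_mult[OF assms, of ?c] admissible_mult[OF assms, of ?c] by simp_all
qed

lemma on_spectrum_cong:
  assumes "\<forall>t\<in>real_spectrum A. f t = g t"
  shows "on_spectrum f = on_spectrum g"
proof (rule ext)
  show "on_spectrum f t = on_spectrum g t" for t
    using assms subsetD[OF approximate_spectrum_subset, of t] by (simp add: on_spectrum_def)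
qed

lemma calculus_on_spectrum_tendsto:
  assumes "f \<in> bounded_borel_on (real_spectrum A)" "\<And>n. F n \<in> bounded_borel_on (real_spectrum A)"
    and bound: "\<And>n t. t \<in> real_spectrum A \<Longrightarrow> \<bar>F n t\<bar> \<le> C"
    and lim: "\<And>t. t \<in> real_spectrum A \<Longrightarrow> (\<lambda>n. F n t) \<longlonglongrightarrow> f t"
  shows "(\<lambda>n. calculus (on_spectrum (F n)) x) \<longlonglongrightarrow> calculus (on_spectrum f) x"
proof (rule calculus_bounded_tendsto[where C = "\<bar>C\<bar>"])
  show "admissible (on_spectrum f)" "admissible (on_spectrum (F n))" for n
    by (intro admissible_on_spectrum assms)+
  show "\<bar>on_spectrum (F n) t\<bar> \<le> \<bar>C\<bar>" for n t
    using bound[OF subsetD[OF approximate_spectrum_subset, of t], of n] by (force simp: on_spectrum_def)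
  show "(\<lambda>n. on_spectrum (F n) t) \<longlonglongrightarrow> on_spectrum f t" for t
    using lim[OF subsetD[OF approximate_spectrum_subset, of t]] by (simp add: on_spectrum_def)
qed

lemma borel_calculus_exists: "borel_calculus A (\<lambda>f. calculus (on_spectrum f))"
proof -
  note adm = admissible_on_spectrum
  have algebra: "on_spectrum (\<lambda>t. f t + g t) = (\<lambda>t. on_spectrum f t + on_spectrum g t)"
    "on_spectrum (\<lambda>t. f t * g t) = (\<lambda>t. on_spectrum f t * on_spectrum g t)"
    "on_spectrum (\<lambda>t. c * f t) = (\<lambda>t. c * on_spectrum f t)" for f g c
    by (auto simp: on_spectrum_def)
  have units: "calculus (on_spectrum (\<lambda>t. 1)) = id_blinfun" "calculus (on_spectrum (\<lambda>t. t)) = A"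
    by (simp_all add: calculus_on_spectrum calculus_const calculus_ident admissible_const admissible_ident)
  show ?thesis
    unfolding borel_calculus_def Let_def
  proof (intro conjI ballI allI impI)
    fix f g assume f: "f \<in> bounded_borel_on (real_spectrum A)" and g: "g \<in> bounded_borel_on (real_spectrum A)"
    show "calculus (on_spectrum (\<lambda>t. f t + g t)) = calculus (on_spectrum f) + calculus (on_spectrum g)"
      unfolding algebra(1) by (rule calculus_add[OF adm[OF f] adm[OF g]])
    show "calculus (on_spectrum (\<lambda>t. f t * g t)) = calculus (on_spectrum f) o\<^sub>L calculus (on_spectrum g)"
      unfolding algebra(2) by (rule calculus_mult[OF adm[OF f] adm[OF g]])
  next
    fix f g :: "real \<Rightarrow> real" assume "\<forall>t\<in>real_spectrum A. f t = g t"
    then show "calculus (on_spectrum f) = calculus (on_spectrum g)"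
      by (simp only: on_spectrum_cong[of f g])
  next
    fix f c assume f: "f \<in> bounded_borel_on (real_spectrum A)"
    show "calculus (on_spectrum (\<lambda>t. c * f t)) = c *\<^sub>R calculus (on_spectrum f)"
      unfolding algebra(3) by (rule calculus_scale[OF adm[OF f]])
    show "self_adjoint (calculus (on_spectrum f))"
      by (rule self_adjoint_calculus[OF adm[OF f]])
  next
    fix F f C x
    assume "f \<in> bounded_borel_on (real_spectrum A)"
      and "(\<forall>n. F n \<in> bounded_borel_on (real_spectrum A)) \<and> (\<forall>n. \<forall>t\<in>real_spectrum A. \<bar>F n t\<bar> \<le> C)
        \<and> (\<forall>t\<in>real_spectrum A. (\<lambda>n. F n t) \<longlonglongrightarrow> f t)"
    then show "(\<lambda>n. calculus (on_spectrum (F n)) x) \<longlonglongrightarrow> calculus (on_spectrum f) x"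
      by (intro calculus_on_spectrum_tendsto[where C = C]) simp_all
  qed (rule units)+
qed

text \<open>For \<open>z\<close> outside of \<open>[0, M]\<close> the function \<open>q(t) = \<bar>t - z\<bar>\<^sup>2\<close> has no zero on the
interval, so \<open>q(A) = (A - z)(A - cnj z)\<close> is inverted by the calculus, and
\<open>(A - cnj z) (1/q)(A)\<close> is the resolvent.\<close>

lemma spectrum_subset: "spectrum A \<subseteq> complex_of_real ` {0..M}"
proof
  fix z assume z: "z \<in> spectrum A"
  show "z \<in> complex_of_real ` {0..M}"
  proof (rule ccontr)
    assume out: "z \<notin> complex_of_real ` {0..M}"
    \<comment> \<open>This is \<open>(t - z) * (t - cnj z)\<close>, written as a real polynomial.\<close>
    define q where "q t = t * t - (2 * Re z) * t + ((Re z)\<^sup>2 + (Im z)\<^sup>2)" for t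
    have q_eq: "q t = (t - Re z)\<^sup>2 + (Im z)\<^sup>2" for t
      by (simp add: q_def power2_eq_square algebra_simps)
    have q_nonzero: "q t \<noteq> 0" if "t \<in> {0..M}" for t
    proof
      assume "q t = 0"
      then have "z = complex_of_real t"
        by (simp add: q_eq sum_power2_eq_zero_iff complex_eq_iff)
      with out that show False by blast
    qed
    define r where "r t = 1 / q t" for t
    have q: "admissible q"
      unfolding q_def by (intro admissible_intros)
    have "continuous_on {0..M} r"
      unfolding r_def q_def using q_nonzero by (intro continuous_intros) (auto simp: q_def)
    then have "bounded (r ` {0..M})"
      by (intro compact_imp_bounded compact_continuous_image) auto
    then have r: "admissible r"
      unfolding admissible_def r_def using admissible_measurable[OF q] by (auto simp: bounded_iff)
    define R where "R = calculus r"
    have calc_q: "calculus q y = A (A y) - (2 * Re z) *\<^sub>R A y + ((Re z)\<^sup>2 + (Im z)\<^sup>2) *\<^sub>R y" for y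
    proof -
      have "calculus q = calculus (\<lambda>t. t * t - (2 * Re z) * t) + calculus (\<lambda>t. (Re z)\<^sup>2 + (Im z)\<^sup>2)"
        unfolding q_def by (intro calculus_add admissible_intros)
      also have "calculus (\<lambda>t. t * t - (2 * Re z) * t) = calculus (\<lambda>t. t * t) - calculus (\<lambda>t. (2 * Re z) * t)"
        by (intro calculus_diff admissible_intros)
      also have "calculus (\<lambda>t. t * t) = A o\<^sub>L A"
        by (simp only: calculus_mult[OF admissible_ident admissible_ident] calculus_ident)
      also have "calculus (\<lambda>t. (2 * Re z) * t) = (2 * Re z) *\<^sub>R A"
        by (simp only: calculus_scale[OF admissible_ident] calculus_ident)
      finally show ?thesis
        by (simp add: calculus_const blinfun.bilinear_simps)
    qed
    have inverse: "calculus q (R x) = x" for x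
    proof -
      have "calculus q o\<^sub>L R = calculus (\<lambda>t. q t * r t)"
        by (simp only: R_def calculus_mult[OF q r])
      also have "\<dots> = calculus (\<lambda>t. 1)"
        by (rule calculus_cong[OF admissible_mult[OF q r] admissible_const]) (simp add: r_def q_nonzero)
      also have "\<dots> = id_blinfun"
        by (simp add: calculus_const)
      finally have "calculus q o\<^sub>L R = id_blinfun" .
      from arg_cong[OF this, of "\<lambda>S. blinfun_apply S x"] show ?thesis
        by simp
    qed
    have R_A: "R (A x) = A (R x)" for x
    proof -
      have "R o\<^sub>L A = calculus (\<lambda>t. r t * t)"
        by (simp only: R_def calculus_mult[OF r admissible_ident] calculus_ident)
      also have "\<dots> = calculus (\<lambda>t. t * r t)"
        by (simp only: mult.commute)
      also have "\<dots> = A o\<^sub>L R"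
        by (simp only: R_def calculus_mult[OF admissible_ident r] calculus_ident)
      finally have "R o\<^sub>L A = A o\<^sub>L R" .
      from arg_cong[OF this, of "\<lambda>S. blinfun_apply S x"] show ?thesis
        by simp
    qed
    have A_scaleC: "A (c *\<^sub>C x) = c *\<^sub>C A x" for c x
      using self_adjoint_A by (simp add: self_adjoint_def bounded_ops_def)
    have scaleC_diff: "c *\<^sub>C (x - y) = c *\<^sub>C x - c *\<^sub>C y" for c and x y :: 'a
      by (rule linear_diff[OF bounded_linear.linear[OF bounded_linear_scaleC]])
    define D where "D w x = A x - w *\<^sub>C x" for w x
    have D_D: "D w (D (cnj w) y) = A (A y) - (2 * Re w) *\<^sub>R A y + ((Re w)\<^sup>2 + (Im w)\<^sup>2) *\<^sub>R y" for w y
    proof -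
      have "D w (D (cnj w) y) = A (A y) - (w + cnj w) *\<^sub>C A y + (w * cnj w) *\<^sub>C y"
        by (simp add: D_def blinfun.diff_right A_scaleC scaleC_diff scaleC_add_left scaleC_scaleC)
      also have "w + cnj w = complex_of_real (2 * Re w)"
        by (simp add: complex_add_cnj)
      also have "w * cnj w = complex_of_real ((Re w)\<^sup>2 + (Im w)\<^sup>2)"
        by (simp add: complex_mult_cnj)
      finally show ?thesis
        by (simp only: scaleC_of_real)
    qed
    have R_D: "R (D w x) = D w (R x)" for w x
      by (simp add: D_def blinfun.diff_right R_A) (simp add: R_def calculus_scaleC[OF r])
    define B where "B = (A - scaleC_op (cnj z) id_blinfun) o\<^sub>L R"
    have B: "B x = D (cnj z) (R x)" for x
      by (simp add: B_def D_def blinfun.diff_left scaleC_op_apply)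
    have D: "(A - scaleC_op z id_blinfun) x = D z x" for x
      by (simp add: D_def blinfun.diff_left scaleC_op_apply)
    have "B \<in> bounded_ops"
      by (simp add: bounded_ops_def B D_def A_scaleC scaleC_diff scaleC_scaleC mult.commute R_def calculus_scaleC[OF r])
    moreover have "B o\<^sub>L (A - scaleC_op z id_blinfun) = id_blinfun"
      using D_D[of "cnj z"] by (intro blinfun_eqI) (simp add: B D R_D calc_q[symmetric] inverse)
    moreover have "(A - scaleC_op z id_blinfun) o\<^sub>L B = id_blinfun"
      using D_D[of z] by (intro blinfun_eqI) (simp add: B D calc_q[symmetric] inverse)
    ultimately show False
      using z by (auto simp: spectrum_def)
  qed
qed

end

lemma positive_op_bounded:
  assumes "positive_op A"
  shows "bounded_positive_operator A (norm A + 1)"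
proof
  show "self_adjoint A" "0 \<le> rinner x (A x)" for x
    using assms by (auto simp: positive_op_def rinner_def)
  show "rinner x (A x) \<le> (norm A + 1) * (norm x)\<^sup>2" for x
  proof -
    have "rinner x (A x) \<le> norm x * (norm A * norm x)"
      using rinner_le_norm[of x "A x"] mult_left_mono[OF norm_blinfun[of A x], of "norm x"] by simp
    also have "\<dots> \<le> (norm A + 1) * (norm x)\<^sup>2"
      by (simp add: power2_eq_square algebra_simps)
    finally show ?thesis .
  qed
qed (simp add: add_nonneg_pos)

section \<open>Splitting a concave function along a tangent\<close>

lemma concave_three_points:
  fixes f :: "real \<Rightarrow> real"
  assumes "concave_on {0..} f" "0 \<le> r" "r \<le> s" "s \<le> t"
  shows "(t - s) * f r + (s - r) * f t \<le> (t - r) * f s"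
proof (cases "r = t")
  case False
  then have pos: "0 < t - r" using assms by simp
  define u v where "u = (t - s) / (t - r)" and "v = (s - r) / (t - r)"
  have uv: "0 \<le> u" "0 \<le> v" "u + v = 1"
    using assms pos by (auto simp: u_def v_def add_divide_distrib[symmetric])
  have "u * r + v * t = ((t - s) * r + (s - r) * t) / (t - r)"
    by (simp add: u_def v_def add_divide_distrib)
  also have "(t - s) * r + (s - r) * t = s * (t - r)"
    by (simp add: algebra_simps)
  finally have s: "u * r + v * t = s"
    using pos by simp
  have "convex_on {0..} (\<lambda>x. - f x)"
    using assms(1) by (simp add: concave_on_def)
  then have "- f (u *\<^sub>R r + v *\<^sub>R t) \<le> u * (- f r) + v * (- f t)"
    using assms uv by (simp only: convex_on_def) (auto)
  then have "u * f r + v * f t \<le> f s"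
    by (simp add: s)
  then have "(t - r) * (u * f r + v * f t) \<le> (t - r) * f s"
    using pos by simp
  moreover have "(t - r) * u = t - s" "(t - r) * v = s - r"
    using pos by (simp_all add: u_def v_def)
  ultimately show ?thesis
    by (metis distrib_left mult.assoc)
qed (use assms in auto)

text \<open>If the function decreased somewhere, the chord through the two points would become negative far to the
right, and the function lies below it there.\<close>

lemma concave_nonneg_mono:
  fixes f :: "real \<Rightarrow> real"
  assumes "concave_on {0..} f" "\<And>t. 0 \<le> t \<Longrightarrow> 0 \<le> f t" "0 \<le> r" "r \<le> s"
  shows "f r \<le> f s"
proof (rule ccontr)
  assume "\<not> f r \<le> f s"
  then have less: "0 < f r - f s" by simp
  have rs: "r < s"
    using less assms(4) by (cases "r = s") auto
  \<comment> \<open>The chord through the points at \<open>r\<close> and \<open>s\<close> has become negative at this \<open>t\<close>.\<close>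
  define t where "t = s + ((s - r) * f s + 1) / (f r - f s)"
  have "0 \<le> f s"
    using assms by simp
  then have "s \<le> t"
    using rs less by (simp add: t_def)
  then have "0 \<le> f t"
    using assms(2)[of t] assms(3,4) by linarith
  have "(t - s) * f r + (s - r) * f t \<le> (t - r) * f s"
    by (rule concave_three_points[OF assms(1,3,4) \<open>s \<le> t\<close>])
  moreover have "0 \<le> (s - r) * f t"
    using \<open>0 \<le> f t\<close> rs by simp
  ultimately have "(t - s) * f r \<le> (t - r) * f s"
    by linarith
  moreover have "(t - r) * f s = (t - s) * f s + (s - r) * f s"
    by (simp add: algebra_simps)
  ultimately have "(t - s) * (f r - f s) \<le> (s - r) * f s"
    by (simp add: algebra_simps)
  moreover have "(t - s) * (f r - f s) = (s - r) * f s + 1"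
    using less by (simp add: t_def)
  ultimately show False by simp
qed

text \<open>The right derivative at \<open>d\<close> works: slopes to the right of \<open>d\<close> are bounded by it and slopes to the left
are at least as large.\<close>

lemma concave_supporting_slope:
  fixes f :: "real \<Rightarrow> real"
  assumes concave: "concave_on {0..} f" and nonneg: "\<And>t. 0 \<le> t \<Longrightarrow> 0 \<le> f t" and d: "0 < d"
  shows "\<exists>c\<ge>0. \<forall>t\<ge>0. f t \<le> f d + c * (t - d)"
proof -
  define slope where "slope t = (f t - f d) / (t - d)" for t
  define c where "c = Sup (slope ` {d<..})"
  have below: "slope t \<le> (f d - f s) / (d - s)" if "0 \<le> s" "s < d" "d < t" for s t
  proof -
    have "(t - d) * f s + (d - s) * f t \<le> (t - s) * f d"
      using concave_three_points[OF concave, of s d t] that by simp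
    then have "(f t - f d) * (d - s) \<le> (f d - f s) * (t - d)"
      by (simp add: algebra_simps)
    then show ?thesis
      using that by (simp add: slope_def divide_le_eq le_divide_eq mult.commute)
  qed
  have bdd: "bdd_above (slope ` {d<..})"
    using below[of 0] d by (intro bdd_aboveI[of _ "(f d - f 0) / d"]) auto
  have upper: "slope t \<le> c" if "d < t" for t
    unfolding c_def using bdd that by (intro cSup_upper) auto
  have lower: "c \<le> (f d - f s) / (d - s)" if "0 \<le> s" "s < d" for s
    unfolding c_def using below that by (intro cSup_least) (auto simp: image_iff intro: exI[of _ "d + 1"])
  have "f d \<le> f (d + 1)"
    using concave_nonneg_mono[OF concave nonneg, of d "d + 1"] d by simp
  then have "0 \<le> slope (d + 1)"
    by (simp add: slope_def)
  also have "\<dots> \<le> c"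
    by (rule upper) simp
  finally have "0 \<le> c" .
  moreover have "f t \<le> f d + c * (t - d)" if "0 \<le> t" for t
  proof -
    consider "t < d" | "t = d" | "d < t" by linarith
    then show ?thesis
    proof cases
      case 1
      then have "c * (d - t) \<le> f d - f t"
        using lower[of t] that by (simp add: pos_le_divide_eq)
      then show ?thesis by (simp add: algebra_simps)
    next
      case 3
      then have "f t - f d \<le> c * (t - d)"
        using upper[of t] by (simp add: slope_def pos_divide_le_eq)
      then show ?thesis by simp
    qed simp
  qed
  ultimately show ?thesis by blast
qed

text \<open>The function \<open>f\<close> with its part to the left of \<open>d\<close> replaced by the line of slope \<open>c\<close> through
\<open>(d, f d)\<close>. This removes a possible jump or steep increase of \<open>f\<close> at 0.\<close>

definition tangent_extension :: "(real \<Rightarrow> real) \<Rightarrow> real \<Rightarrow> real \<Rightarrow> real \<Rightarrow> real" where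
  "tangent_extension f d c t = (if t \<le> d then f d + c * (t - d) else f t)"

lemma tangent_extension_increment:
  fixes f :: "real \<Rightarrow> real"
  assumes concave: "concave_on {0..} f" and nonneg: "\<And>t. 0 \<le> t \<Longrightarrow> 0 \<le> f t"
    and d: "0 < d" and c: "0 \<le> c" and support: "\<And>t. 0 \<le> t \<Longrightarrow> f t \<le> f d + c * (t - d)"
    and st: "0 \<le> s" "s \<le> t"
  shows "0 \<le> tangent_extension f d c t - tangent_extension f d c s"
    and "tangent_extension f d c t - tangent_extension f d c s \<le> c * (t - s)"
proof -
  note mono = concave_nonneg_mono[OF concave nonneg]
  consider "t \<le> d" | "s \<le> d" "d < t" | "d < s" by linarith
  then have "0 \<le> tangent_extension f d c t - tangent_extension f d c s
      \<and> tangent_extension f d c t - tangent_extension f d c s \<le> c * (t - s)"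
  proof cases
    case 1
    then have "tangent_extension f d c t - tangent_extension f d c s = c * (t - s)"
      using st by (simp add: tangent_extension_def algebra_simps)
    then show ?thesis using c st by simp
  next
    case 2
    have eq: "tangent_extension f d c t - tangent_extension f d c s = (f t - f d) + c * (d - s)"
      using 2 by (simp add: tangent_extension_def algebra_simps)
    have "f t - f d \<le> c * (t - d)" "c * (t - s) = c * (t - d) + c * (d - s)"
      using support[of t] st by (simp_all add: algebra_simps)
    moreover have "0 \<le> f t - f d" "0 \<le> c * (d - s)"
      using mono[of d t] 2 d c by simp_all
    ultimately show ?thesis
      unfolding eq by linarith
  next
    case 3
    then have eq: "tangent_extension f d c t - tangent_extension f d c s = f t - f s"
      using st by (simp add: tangent_extension_def)
    have "(t - s) * f d + (s - d) * f t \<le> (t - d) * f s"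
      using concave_three_points[OF concave, of d s t] 3 d st by simp
    then have "(s - d) * (f t - f s) \<le> (t - s) * (f s - f d)"
      by (simp add: algebra_simps)
    also have "\<dots> \<le> (t - s) * (c * (s - d))"
      using support[of s] st by (intro mult_left_mono) auto
    also have "\<dots> = (s - d) * (c * (t - s))"
      by (simp add: ac_simps)
    finally have "f t - f s \<le> c * (t - s)"
      using 3 by (simp add: mult_le_cancel_left)
    then show ?thesis
      unfolding eq using mono[of s t] st by simp
  qed
  then show "0 \<le> tangent_extension f d c t - tangent_extension f d c s"
    and "tangent_extension f d c t - tangent_extension f d c s \<le> c * (t - s)"
    by auto
qed

lemma increment_lipschitz:
  fixes h :: "real \<Rightarrow> real"
  assumes "0 \<le> c" "\<And>s t. 0 \<le> s \<Longrightarrow> s \<le> t \<Longrightarrow> 0 \<le> h t - h s"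
    and "\<And>s t. 0 \<le> s \<Longrightarrow> s \<le> t \<Longrightarrow> h t - h s \<le> c * (t - s)"
  shows "c-lipschitz_on {0..} h"
proof (rule lipschitz_onI)
  fix s t :: real assume "s \<in> {0..}" "t \<in> {0..}"
  then show "dist (h s) (h t) \<le> c * dist s t"
  proof (induction s t rule: linorder_wlog)
    case (le s t)
    then show ?case
      using assms(2,3)[of s t] by (simp add: dist_real_def abs_if)
  next
    case (sym s t)
    then show ?case by (simp add: dist_commute)
  qed
qed (rule assms(1))

text \<open>The remainder vanishes to the right of \<open>d\<close>. To the left, \<open>f\<close> lies below the supporting line and,
by concavity, above the chord from \<open>(0, 0)\<close> to \<open>(d, f d)\<close>, whose slope is at least \<open>c\<close>.\<close>

lemma tangent_extension_remainder:
  fixes f :: "real \<Rightarrow> real"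
  assumes concave: "concave_on {0..} f" and nonneg: "\<And>t. 0 \<le> t \<Longrightarrow> 0 \<le> f t"
    and d: "0 < d" and support: "\<And>t. 0 \<le> t \<Longrightarrow> f t \<le> f d + c * (t - d)"
    and t: "0 \<le> t"
  shows "f t - tangent_extension f d c t \<le> 0"
    and "c * d - f d \<le> f t - tangent_extension f d c t"
proof -
  show "f t - tangent_extension f d c t \<le> 0"
    using support[OF t] by (simp add: tangent_extension_def)
  show "c * d - f d \<le> f t - tangent_extension f d c t"
  proof (cases "t \<le> d")
    case True
    have "(d - t) * f 0 + (t - 0) * f d \<le> (d - 0) * f t"
      by (rule concave_three_points[OF concave _ t True]) simp
    moreover have "0 \<le> (d - t) * f 0"
      using True nonneg[of 0] by simp
    ultimately have "t * f d \<le> d * f t"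
      by simp
    moreover have "t * (c * d) \<le> t * f d"
      using support[of 0] nonneg[of 0] t by (intro mult_left_mono) auto
    ultimately have "d * (c * t) \<le> d * f t"
      by (simp add: ac_simps)
    then have "c * t \<le> f t"
      using d by simp
    then show ?thesis
      using True by (simp add: tangent_extension_def algebra_simps)
  next
    case False
    then show ?thesis
      using support[of 0] nonneg[of 0] by (simp add: tangent_extension_def)
  qed
qed

section \<open>Unitarily invariant norms on operator ideals\<close>

locale unitarily_invariant_ideal =
  fixes J :: "('a::complex_hilbert_space \<Rightarrow>\<^sub>L 'a) set" and N :: "('a \<Rightarrow>\<^sub>L 'a) \<Rightarrow> real"
  assumes unitarily_invariant: "unitarily_invariant_norm J N"
begin

lemma ideal: "two_sided_ideal J" and norm: "norm_on J N"
  using unitarily_invariant by (simp_all add: unitarily_invariant_norm_def)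

lemma
  shows J_zero: "0 \<in> J"
    and J_add: "X \<in> J \<Longrightarrow> Y \<in> J \<Longrightarrow> X + Y \<in> J"
    and J_scaleC: "X \<in> J \<Longrightarrow> scaleC_op c X \<in> J"
    and J_compose_left: "S \<in> bounded_ops \<Longrightarrow> X \<in> J \<Longrightarrow> S o\<^sub>L X \<in> J"
    and J_compose_right: "S \<in> bounded_ops \<Longrightarrow> X \<in> J \<Longrightarrow> X o\<^sub>L S \<in> J"
  using ideal by (auto simp: two_sided_ideal_def)

lemma
  shows N_nonneg: "X \<in> J \<Longrightarrow> 0 \<le> N X"
    and N_eq_0_iff: "X \<in> J \<Longrightarrow> N X = 0 \<longleftrightarrow> X = 0"
    and N_scaleC: "X \<in> J \<Longrightarrow> N (scaleC_op c X) = cmod c * N X"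
    and N_triangle: "X \<in> J \<Longrightarrow> Y \<in> J \<Longrightarrow> N (X + Y) \<le> N X + N Y"
  using norm by (simp_all add: norm_on_def)

lemma N_unitary: "X \<in> J \<Longrightarrow> unitary_op U \<Longrightarrow> unitary_op V \<Longrightarrow> N (U o\<^sub>L X o\<^sub>L V) = N X"
  using unitarily_invariant by (simp add: unitarily_invariant_norm_def)

lemma scaleR_eq_scaleC_op: "r *\<^sub>R X = scaleC_op (complex_of_real r) X" for X :: "'a \<Rightarrow>\<^sub>L 'a"
  by (rule blinfun_eqI) (simp add: scaleC_op.rep_eq scaleC_of_real blinfun.scaleR_left)

lemma J_scaleR: "X \<in> J \<Longrightarrow> r *\<^sub>R X \<in> J"
  by (simp add: scaleR_eq_scaleC_op J_scaleC)

lemma N_scaleR: "X \<in> J \<Longrightarrow> N (r *\<^sub>R X) = \<bar>r\<bar> * N X"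
  by (simp add: scaleR_eq_scaleC_op N_scaleC)

lemma J_diff: "X \<in> J \<Longrightarrow> Y \<in> J \<Longrightarrow> X - Y \<in> J"
  using J_add[of X "(-1) *\<^sub>R Y"] J_scaleR[of Y "-1"] by simp

lemma N_diff_le: "X \<in> J \<Longrightarrow> Y \<in> J \<Longrightarrow> N (X - Y) \<le> N X + N Y"
  using N_triangle[of X "(-1) *\<^sub>R Y"] J_scaleR[of Y "-1"] N_scaleR[of Y "-1"] by simp

lemma commutator_in_J: "S \<in> bounded_ops \<Longrightarrow> X \<in> J \<Longrightarrow> commutator S X \<in> J"
  unfolding commutator_def by (intro J_diff J_compose_left J_compose_right)

lemma unitary_op_id: "unitary_op (id_blinfun :: 'a \<Rightarrow>\<^sub>L 'a)"
  by (simp add: unitary_op_def bounded_ops_def)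

lemma N_unitary_compose:
  assumes "X \<in> J" "unitary_op U"
  shows "N (U o\<^sub>L X) = N X" "N (X o\<^sub>L U) = N X"
proof -
  have "U o\<^sub>L X o\<^sub>L id_blinfun = U o\<^sub>L X" "id_blinfun o\<^sub>L X o\<^sub>L U = X o\<^sub>L U"
    by (rule blinfun_eqI, simp)+
  then show "N (U o\<^sub>L X) = N X" "N (X o\<^sub>L U) = N X"
    using N_unitary[OF assms unitary_op_id] N_unitary[OF assms(1) unitary_op_id assms(2)] by simp_all
qed

lemma N_half_sum_unitary:
  assumes "X \<in> J" "unitary_op U" "unitary_op V" "2 *\<^sub>R S = U + V"
  shows "N (S o\<^sub>L X) \<le> N X" "N (X o\<^sub>L S) \<le> N X"
proof -
  have S: "S = (1 / 2) *\<^sub>R (U + V)"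
    by (simp add: assms(4)[symmetric])
  have J: "U o\<^sub>L X \<in> J" "V o\<^sub>L X \<in> J" "X o\<^sub>L U \<in> J" "X o\<^sub>L V \<in> J"
    using assms by (auto simp: unitary_op_def intro: J_compose_left J_compose_right)
  have "S o\<^sub>L X = (1 / 2) *\<^sub>R ((U o\<^sub>L X) + (V o\<^sub>L X))" "X o\<^sub>L S = (1 / 2) *\<^sub>R ((X o\<^sub>L U) + (X o\<^sub>L V))"
    unfolding S by (rule blinfun_eqI, simp add: blinfun.bilinear_simps)+
  moreover have "N ((U o\<^sub>L X) + (V o\<^sub>L X)) \<le> N X + N X" "N ((X o\<^sub>L U) + (X o\<^sub>L V)) \<le> N X + N X"
    using N_triangle[OF J(1,2)] N_triangle[OF J(3,4)]
      N_unitary_compose[OF assms(1,2)] N_unitary_compose[OF assms(1,3)] by simp_all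
  ultimately show "N (S o\<^sub>L X) \<le> N X" "N (X o\<^sub>L S) \<le> N X"
    using J by (simp_all add: N_scaleR J_add)
qed

end

section \<open>Unitaries from the calculus\<close>

locale borel_calculus_operator =
  fixes A :: "'a::complex_hilbert_space \<Rightarrow>\<^sub>L 'a" and \<Phi> :: "(real \<Rightarrow> real) \<Rightarrow> ('a \<Rightarrow>\<^sub>L 'a)"
  assumes borel_calculus: "borel_calculus A \<Phi>"
begin

abbreviation "\<sigma> \<equiv> real_spectrum A"
abbreviation "\<B> \<equiv> bounded_borel_on \<sigma>"

lemmas calculus_properties = borel_calculus[unfolded borel_calculus_def Let_def]

lemmas \<Phi>_self_adjoint = calculus_properties[THEN conjunct1, rule_format]
lemmas \<Phi>_add = calculus_properties[THEN conjunct2, THEN conjunct2, THEN conjunct1, rule_format]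
lemmas \<Phi>_scale = calculus_properties[THEN conjunct2, THEN conjunct2, THEN conjunct2, THEN conjunct1, rule_format]
lemmas \<Phi>_mult = calculus_properties[THEN conjunct2, THEN conjunct2, THEN conjunct2, THEN conjunct2, THEN conjunct1, rule_format]
lemmas \<Phi>_one = calculus_properties[THEN conjunct2, THEN conjunct2, THEN conjunct2, THEN conjunct2, THEN conjunct2, THEN conjunct1, rule_format]

lemma \<Phi>_cong: "f \<in> \<B> \<Longrightarrow> g \<in> \<B> \<Longrightarrow> (\<And>t. t \<in> \<sigma> \<Longrightarrow> f t = g t) \<Longrightarrow> \<Phi> f = \<Phi> g"
  by (rule calculus_properties[THEN conjunct2, THEN conjunct1, rule_format]) auto

lemma \<Phi>_tendsto:
  assumes "f \<in> \<B>" "\<And>n. F n \<in> \<B>" "\<And>n t. t \<in> \<sigma> \<Longrightarrow> \<bar>F n t\<bar> \<le> C"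
    and "\<And>t. t \<in> \<sigma> \<Longrightarrow> (\<lambda>n. F n t) \<longlonglongrightarrow> f t"
  shows "(\<lambda>n. \<Phi> (F n) x) \<longlonglongrightarrow> \<Phi> f x"
proof -
  have "\<forall>F. \<forall>f\<in>\<B>. \<forall>M. (\<forall>n. F n \<in> \<B>) \<and> (\<forall>n. \<forall>t\<in>\<sigma>. \<bar>F n t\<bar> \<le> M) \<and> (\<forall>t\<in>\<sigma>. (\<lambda>n. F n t) \<longlonglongrightarrow> f t)
      \<longrightarrow> (\<forall>x. (\<lambda>n. \<Phi> (F n) x) \<longlonglongrightarrow> \<Phi> f x)"
    using borel_calculus unfolding borel_calculus_def Let_def by (elim conjE)
  from this[rule_format, OF assms(1), of F C x] show ?thesis
    using assms(2-4) by simp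
qed

lemma \<B>_I:
  "f \<in> borel_measurable (restrict_space borel \<sigma>) \<Longrightarrow> (\<And>t. t \<in> \<sigma> \<Longrightarrow> \<bar>f t\<bar> \<le> C) \<Longrightarrow> f \<in> \<B>"
  by (auto simp: bounded_borel_on_def bounded_iff)

lemma \<B>_measurable: "f \<in> \<B> \<Longrightarrow> f \<in> borel_measurable (restrict_space borel \<sigma>)"
  by (simp add: bounded_borel_on_def)

lemma \<B>_bound: "f \<in> \<B> \<Longrightarrow> \<exists>C. \<forall>t\<in>\<sigma>. \<bar>f t\<bar> \<le> C"
  by (auto simp: bounded_borel_on_def bounded_iff)

lemma \<B>_const: "(\<lambda>t. c) \<in> \<B>"
  by (rule \<B>_I[of _ "\<bar>c\<bar>"]) simp_all

lemma \<B>_add: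
  assumes "f \<in> \<B>" "g \<in> \<B>"
  shows "(\<lambda>t. f t + g t) \<in> \<B>"
proof -
  obtain C where C: "\<forall>t\<in>\<sigma>. \<bar>f t\<bar> \<le> C"
    using \<B>_bound[OF assms(1)] by blast
  obtain D where D: "\<forall>t\<in>\<sigma>. \<bar>g t\<bar> \<le> D"
    using \<B>_bound[OF assms(2)] by blast
  show ?thesis
  proof (rule \<B>_I)
    show "\<bar>f t + g t\<bar> \<le> C + D" if "t \<in> \<sigma>" for t
      using bspec[OF C that] bspec[OF D that] by linarith
  qed (intro borel_measurable_add \<B>_measurable assms)
qed

lemma \<B>_scale:
  assumes "f \<in> \<B>"
  shows "(\<lambda>t. c * f t) \<in> \<B>"
proof -
  obtain C where C: "\<forall>t\<in>\<sigma>. \<bar>f t\<bar> \<le> C"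
    using \<B>_bound[OF assms] by blast
  show ?thesis
  proof (rule \<B>_I)
    show "\<bar>c * f t\<bar> \<le> \<bar>c\<bar> * C" if "t \<in> \<sigma>" for t
      using bspec[OF C that] by (simp add: abs_mult mult_left_mono)
  qed (intro borel_measurable_times borel_measurable_const \<B>_measurable assms)
qed

lemma \<B>_mult:
  assumes "f \<in> \<B>" "g \<in> \<B>"
  shows "(\<lambda>t. f t * g t) \<in> \<B>"
proof -
  obtain C where C: "\<forall>t\<in>\<sigma>. \<bar>f t\<bar> \<le> C"
    using \<B>_bound[OF assms(1)] by blast
  obtain D where D: "\<forall>t\<in>\<sigma>. \<bar>g t\<bar> \<le> D"
    using \<B>_bound[OF assms(2)] by blast
  show ?thesis
  proof (rule \<B>_I)
    show "\<bar>f t * g t\<bar> \<le> C * D" if "t \<in> \<sigma>" for t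
      unfolding abs_mult using bspec[OF C that] bspec[OF D that] by (intro mult_mono) auto
  qed (intro borel_measurable_times \<B>_measurable assms)
qed

lemma \<B>_mono:
  assumes "\<sigma> \<subseteq> {0..M}" "\<And>s t. 0 \<le> s \<Longrightarrow> s \<le> t \<Longrightarrow> f s \<le> f t"
  shows "f \<in> \<B>"
proof (rule \<B>_I)
  show "f \<in> borel_measurable (restrict_space borel \<sigma>)"
    using assms by (intro borel_measurable_mono_on_fnc mono_onI) auto
  show "\<bar>f t\<bar> \<le> \<bar>f 0\<bar> + \<bar>f M\<bar>" if "t \<in> \<sigma>" for t
  proof -
    have "0 \<le> t" "t \<le> M"
      using that assms(1) by auto
    then show ?thesis
      using assms(2)[of 0 t] assms(2)[of t M] by linarith
  qed
qed

lemma \<Phi>_const: "\<Phi> (\<lambda>t. c) = c *\<^sub>R id_blinfun"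
  using \<Phi>_scale[OF \<B>_const[of 1], of c] by (simp add: \<Phi>_one)

lemma \<Phi>_bounded_ops: "f \<in> \<B> \<Longrightarrow> \<Phi> f \<in> bounded_ops"
  using \<Phi>_self_adjoint by (simp add: self_adjoint_def)

text \<open>The operator is the value of the calculus at the function \<open>u + \<i> v\<close> of modulus 1; its inverse and
adjoint is the value at \<open>u - \<i> v\<close>. Since the calculus is given for real functions, this is
computed with the real and imaginary parts.\<close>

lemma unitary_from_circle:
  assumes u: "u \<in> \<B>" and v: "v \<in> \<B>" and circle: "\<And>t. t \<in> \<sigma> \<Longrightarrow> u t * u t + v t * v t = 1"
  shows "unitary_op (\<Phi> u + scaleC_op \<i> (\<Phi> v))"
proof -
  note uu = \<B>_mult[OF u u] and vv = \<B>_mult[OF v v]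
  define P Q where "P = \<Phi> u" and "Q = \<Phi> v"
  define U where "U = P + scaleC_op \<i> Q"
  have U: "U x = P x + \<i> *\<^sub>C Q x" for x
    by (simp add: U_def blinfun.add_left scaleC_op.rep_eq)
  have ops: "P (c *\<^sub>C x) = c *\<^sub>C P x" "Q (c *\<^sub>C x) = c *\<^sub>C Q x" for c x
    using \<Phi>_bounded_ops[OF u] \<Phi>_bounded_ops[OF v] by (simp_all add: P_def Q_def bounded_ops_def)
  have sym: "rinner (P x) y = rinner x (P y)" "rinner (Q x) y = rinner x (Q y)" for x y
    using \<Phi>_self_adjoint[OF u] \<Phi>_self_adjoint[OF v] by (simp_all add: P_def Q_def self_adjoint_iff_rinner)
  have "Q o\<^sub>L P = P o\<^sub>L Q"
    unfolding P_def Q_def \<Phi>_mult[OF u v, symmetric] \<Phi>_mult[OF v u, symmetric] by (simp only: mult.commute)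
  from arg_cong[OF this, of "\<lambda>S. blinfun_apply S x" for x]
  have comm: "Q (P x) = P (Q x)" for x
    by simp
  have "(P o\<^sub>L P) + (Q o\<^sub>L Q) = \<Phi> (\<lambda>t. u t * u t + v t * v t)"
    by (simp only: P_def Q_def \<Phi>_mult[OF u u] \<Phi>_mult[OF v v] \<Phi>_add[OF uu vv])
  also have "\<dots> = \<Phi> (\<lambda>t. 1)"
    by (rule \<Phi>_cong[OF \<B>_add[OF uu vv] \<B>_const circle])
  finally have "(P o\<^sub>L P) + (Q o\<^sub>L Q) = id_blinfun"
    by (simp only: \<Phi>_one)
  from arg_cong[OF this, of "\<lambda>S. blinfun_apply S x" for x]
  have sum: "P (P x) + Q (Q x) = x" for x
    by (simp add: blinfun.add_left)
  have ii: "\<i> *\<^sub>C (\<i> *\<^sub>C x) = - x" for x :: 'a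
    using scaleC_of_real[of "-1" x] by (simp add: scaleC_scaleC)
  have scaleC_diff: "c *\<^sub>C (x - y) = c *\<^sub>C x - c *\<^sub>C y" for c and x y :: 'a
    by (rule linear_diff[OF bounded_linear.linear[OF bounded_linear_scaleC]])
  have inverse: "U (P x - \<i> *\<^sub>C Q x) = x" "P (U x) - \<i> *\<^sub>C Q (U x) = x" for x
    using sum[of x] by (simp_all add: U blinfun.diff_right blinfun.add_right ops scaleC_diff scaleC_add_right ii comm)
  have "rinner (U x) (U y) = rinner x (P (U y) - \<i> *\<^sub>C Q (U y))" for x y
    unfolding U[of x] by (simp add: rinner.add_left rinner.diff_right rinner_i_left sym ops)
  then have iso: "rinner (U x) (U y) = rinner x y" for x y
    by (simp only: inverse(2))
  have U_ops: "U (c *\<^sub>C x) = c *\<^sub>C U x" for c x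
    by (simp add: U ops scaleC_add_right scaleC_scaleC mult.commute)
  have "cinner (U x) (U y) = cinner x y" for x y
  proof (rule complex_eqI)
    show "Re (cinner (U x) (U y)) = Re (cinner x y)"
      using iso by (simp add: rinner_def)
    show "Im (cinner (U x) (U y)) = Im (cinner x y)"
      by (simp only: Im_cinner U_ops[symmetric] iso)
  qed
  moreover have "surj (blinfun_apply U)"
    by (rule surjI[where f = "\<lambda>x. P x - \<i> *\<^sub>C Q x"]) (rule inverse(1))
  ultimately have "unitary_op U"
    by (simp add: unitary_op_def bounded_ops_def U_ops)
  then show ?thesis
    by (simp add: U_def P_def Q_def)
qed

end

section \<open>Commutators with functions of an operator\<close>

lemma commutator_add: "commutator (S + T) X = commutator S X + commutator T X"
  unfolding commutator_def by (rule blinfun_eqI) (simp add: blinfun.bilinear_simps)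

lemma commutator_scaleR: "commutator (c *\<^sub>R S) X = c *\<^sub>R commutator S X"
  unfolding commutator_def by (rule blinfun_eqI) (simp add: blinfun.bilinear_simps scaleR_diff_right)

lemma commutator_eq_0_iff: "commutator S X = 0 \<longleftrightarrow> (\<forall>x. S (X x) = X (S x))"
proof
  show "\<forall>x. S (X x) = X (S x)" if "commutator S X = 0"
  proof
    show "S (X x) = X (S x)" for x
      using arg_cong[OF that, of "\<lambda>T. blinfun_apply T x"] by (simp add: commutator_def blinfun.diff_left)
  qed
  show "commutator S X = 0" if "\<forall>x. S (X x) = X (S x)"
    using that by (intro blinfun_eqI) (simp add: commutator_def blinfun.diff_left)
qed

locale calculus_in_ideal = unitarily_invariant_ideal J N + borel_calculus_operator A \<Phi>
  for J :: "('a::complex_hilbert_space \<Rightarrow>\<^sub>L 'a) set" and N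
    and A :: "'a \<Rightarrow>\<^sub>L 'a" and \<Phi> :: "(real \<Rightarrow> real) \<Rightarrow> ('a \<Rightarrow>\<^sub>L 'a)"
begin

text \<open>A number in \<open>[-1, 1]\<close> is the mean of two conjugate points on the unit circle.\<close>

lemma N_contraction_compose:
  assumes u: "u \<in> \<B>" and bound: "\<And>t. t \<in> \<sigma> \<Longrightarrow> \<bar>u t\<bar> \<le> 1" and X: "X \<in> J"
  shows "N (\<Phi> u o\<^sub>L X) \<le> N X" "N (X o\<^sub>L \<Phi> u) \<le> N X"
proof -
  \<comment> \<open>The second coordinate of the point on the circle above \<open>u t\<close>; off the spectrum it may be the root of a negative number, which does no harm.\<close>
  define v where "v t = sqrt (1 - u t * u t)" for t
  note [measurable] = \<B>_measurable[OF u]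
  have square: "u t * u t \<le> 1" if "t \<in> \<sigma>" for t
    using bound[OF that] abs_square_le_1[of "u t"] by (simp add: power2_eq_square)
  have circle: "u t * u t + v t * v t = 1" if "t \<in> \<sigma>" for t
    using square[OF that] by (simp add: v_def)
  have v: "v \<in> \<B>"
  proof (rule \<B>_I)
    show "\<bar>v t\<bar> \<le> 1" if "t \<in> \<sigma>" for t
      using square[OF that] by (simp add: v_def)
  qed (simp add: v_def[abs_def])
  have "unitary_op (\<Phi> u + scaleC_op \<i> (\<Phi> v))"
    by (rule unitary_from_circle[OF u v circle])
  moreover have "unitary_op (\<Phi> u + scaleC_op \<i> (\<Phi> (\<lambda>t. (-1) * v t)))"
    using circle by (intro unitary_from_circle u \<B>_scale v) simp_all
  moreover have "2 *\<^sub>R \<Phi> u = (\<Phi> u + scaleC_op \<i> (\<Phi> v)) + (\<Phi> u + scaleC_op \<i> (\<Phi> (\<lambda>t. (-1) * v t)))"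
  proof (rule blinfun_eqI)
    fix x
    have "\<i> *\<^sub>C (- y) = - (\<i> *\<^sub>C y)" for y :: 'a
      by (rule linear_neg[OF bounded_linear.linear[OF bounded_linear_scaleC]])
    then show "(2 *\<^sub>R \<Phi> u) x = ((\<Phi> u + scaleC_op \<i> (\<Phi> v)) + (\<Phi> u + scaleC_op \<i> (\<Phi> (\<lambda>t. (-1) * v t)))) x"
      unfolding \<Phi>_scale[OF v]
      by (simp add: blinfun.add_left blinfun.minus_left blinfun.scaleR_left scaleC_op.rep_eq scaleR_2)
  qed
  ultimately show "N (\<Phi> u o\<^sub>L X) \<le> N X" "N (X o\<^sub>L \<Phi> u) \<le> N X"
    using N_half_sum_unitary[OF X] by blast+
qed

text \<open>Subtracting the midpoint of \<open>[a, b]\<close> from \<open>g\<close> leaves the commutator unchanged and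
the values at most \<open>(b - a) / 2\<close> in modulus; each of the two products in the commutator contributes this factor.\<close>

lemma N_commutator_le_oscillation:
  assumes g: "g \<in> \<B>" and bound: "\<And>t. t \<in> \<sigma> \<Longrightarrow> a \<le> g t \<and> g t \<le> b" and ab: "a \<le> b" and X: "X \<in> J"
  shows "N (commutator (\<Phi> g) X) \<le> (b - a) * N X"
proof (cases "a = b")
  case True
  have "\<Phi> g = \<Phi> (\<lambda>t. a)"
    by (rule \<Phi>_cong[OF g \<B>_const]) (use bound True in force)
  then have "commutator (\<Phi> g) X = 0"
    by (simp add: \<Phi>_const commutator_eq_0_iff blinfun.scaleR_left blinfun.scaleR_right)
  then show ?thesis
    using True N_eq_0_iff[OF J_zero] by simp
next
  case False
  define r where "r = (b - a) / 2"
  have r: "0 < r" using ab False by (simp add: r_def)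
  define u where "u t = (1 / r) * (g t + (- ((a + b) / 2)))" for t
  have u: "u \<in> \<B>"
    unfolding u_def by (intro \<B>_scale \<B>_add g \<B>_const)
  have u_bound: "\<bar>u t\<bar> \<le> 1" if "t \<in> \<sigma>" for t
  proof -
    have "\<bar>g t + (- ((a + b) / 2))\<bar> \<le> r"
      using bound[OF that] by (auto simp: r_def abs_le_iff add_divide_distrib diff_divide_distrib)
    then show ?thesis
      using r by (simp add: u_def abs_mult divide_le_eq)
  qed
  have "\<Phi> g = \<Phi> (\<lambda>t. r * u t + (a + b) / 2)"
    using r by (simp add: u_def)
  also have "\<dots> = r *\<^sub>R \<Phi> u + ((a + b) / 2) *\<^sub>R id_blinfun"
    by (simp only: \<Phi>_add[OF \<B>_scale[OF u] \<B>_const] \<Phi>_scale[OF u] \<Phi>_const)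
  finally have "commutator (\<Phi> g) X = r *\<^sub>R commutator (\<Phi> u) X"
    unfolding commutator_def by (intro blinfun_eqI) (simp add: blinfun.bilinear_simps scaleR_diff_right)
  then have scaled: "N (commutator (\<Phi> g) X) = r * N (commutator (\<Phi> u) X)"
    using r by (simp add: N_scaleR commutator_in_J \<Phi>_bounded_ops u X)
  have "N (commutator (\<Phi> u) X) \<le> N (\<Phi> u o\<^sub>L X) + N (X o\<^sub>L \<Phi> u)"
    unfolding commutator_def
    by (intro N_diff_le J_compose_left J_compose_right \<Phi>_bounded_ops u X)
  also have "\<dots> \<le> N X + N X"
    by (intro add_mono N_contraction_compose u u_bound X)
  finally have "r * N (commutator (\<Phi> u) X) \<le> r * (N X + N X)"
    using r by (intro mult_left_mono) auto
  also have "\<dots> = (b - a) * N X"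
    by (simp add: r_def)
  finally show ?thesis
    by (simp only: scaled)
qed

lemma \<Phi>_limit_commutes:
  assumes "f \<in> \<B>" "\<And>n. F n \<in> \<B>" "\<And>n t. t \<in> \<sigma> \<Longrightarrow> \<bar>F n t\<bar> \<le> C"
    and "\<And>t. t \<in> \<sigma> \<Longrightarrow> (\<lambda>n. F n t) \<longlonglongrightarrow> f t"
    and commute: "\<And>n. commutator (\<Phi> (F n)) X = 0"
  shows "commutator (\<Phi> f) X = 0"
  unfolding commutator_eq_0_iff
proof
  fix x
  have lim: "(\<lambda>n. \<Phi> (F n) y) \<longlonglongrightarrow> \<Phi> f y" for y
    by (rule \<Phi>_tendsto[where C = C]) (use assms in auto)
  have "(\<lambda>n. X (\<Phi> (F n) x)) \<longlonglongrightarrow> X (\<Phi> f x)"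
    by (intro tendsto_intros lim)
  moreover have "X (\<Phi> (F n) x) = \<Phi> (F n) (X x)" for n
    using commute[of n] by (simp add: commutator_eq_0_iff)
  ultimately show "\<Phi> f (X x) = X (\<Phi> f x)"
    using lim[of "X x"] by (simp add: LIMSEQ_unique)
qed

text \<open>The interpolation argument, for any Borel calculus whose Lipschitz functions satisfy the expected
commutator estimate with the given \<open>X\<close>.\<close>

lemma N_commutator_concave:
  assumes \<sigma>: "\<sigma> \<subseteq> {0..M}" and A: "A \<in> bounded_ops" and X: "X \<in> J" "N X \<le> 1"
    and concave: "concave_on {0..} f" and nonneg: "\<And>t. 0 \<le> t \<Longrightarrow> 0 \<le> f t"
    and lipschitz: "\<And>h c. c-lipschitz_on {0..} h \<Longrightarrow> N (commutator (\<Phi> h) X) \<le> c * N (commutator A X)"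
  shows "N (commutator (\<Phi> f) X) \<le> f (N (commutator A X))"
proof -
  define \<delta> where "\<delta> = N (commutator A X)"
  have "0 \<le> \<delta>"
    unfolding \<delta>_def by (intro N_nonneg commutator_in_J A X)
  note mono = concave_nonneg_mono[OF concave nonneg]
  have f: "f \<in> \<B>"
    by (rule \<B>_mono[OF \<sigma> mono])
  have commutator_J: "commutator (\<Phi> h) X \<in> J" if "h \<in> \<B>" for h
    by (intro commutator_in_J \<Phi>_bounded_ops that X)
  have ext: "\<exists>c\<ge>0. c-lipschitz_on {0..} (tangent_extension f d c) \<and> tangent_extension f d c \<in> \<B>
      \<and> (\<forall>t\<ge>0. f t \<le> f d + c * (t - d))" if d: "0 < d" for d
  proof -
    obtain c where c: "0 \<le> c" "\<And>t. 0 \<le> t \<Longrightarrow> f t \<le> f d + c * (t - d)"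
      using concave_supporting_slope[OF concave nonneg d] by blast
    have incr: "0 \<le> tangent_extension f d c t - tangent_extension f d c s"
      "tangent_extension f d c t - tangent_extension f d c s \<le> c * (t - s)" if "0 \<le> s" "s \<le> t" for s t
      using tangent_extension_increment[OF concave nonneg d c that] by auto
    have "c-lipschitz_on {0..} (tangent_extension f d c)"
      by (rule increment_lipschitz[OF c(1) incr])
    moreover have "tangent_extension f d c \<in> \<B>"
      by (rule \<B>_mono[OF \<sigma>]) (use incr(1) in fastforce)
    ultimately show ?thesis
      using c by blast
  qed
  have "N (commutator (\<Phi> f) X) \<le> f \<delta>"
  proof (cases "\<delta> = 0")
    case False
    then have d: "0 < \<delta>" using \<open>0 \<le> \<delta>\<close> by simp
    obtain c where c: "0 \<le> c" and lip: "c-lipschitz_on {0..} (tangent_extension f \<delta> c)"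
      and h: "tangent_extension f \<delta> c \<in> \<B>" and support: "\<And>t. 0 \<le> t \<Longrightarrow> f t \<le> f \<delta> + c * (t - \<delta>)"
      using ext[OF d] by blast
    define g where "g t = f t + (-1) * tangent_extension f \<delta> c t" for t
    have g: "g \<in> \<B>"
      unfolding g_def by (intro \<B>_add \<B>_scale f h)
    have g_bound: "c * \<delta> - f \<delta> \<le> g t \<and> g t \<le> 0" if "t \<in> \<sigma>" for t
      using tangent_extension_remainder[OF concave nonneg d support, of t] that \<sigma> by (auto simp: g_def)
    have slope: "c * \<delta> \<le> f \<delta>"
      using support[of 0] nonneg[of 0] by simp
    have "\<Phi> f = \<Phi> (\<lambda>t. g t + tangent_extension f \<delta> c t)"
      by (simp add: g_def)
    also have "\<dots> = \<Phi> g + \<Phi> (tangent_extension f \<delta> c)"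
      by (rule \<Phi>_add[OF g h])
    finally have "N (commutator (\<Phi> f) X) \<le> N (commutator (\<Phi> g) X) + N (commutator (\<Phi> (tangent_extension f \<delta> c)) X)"
      by (simp only: commutator_add N_triangle commutator_J g h)
    moreover have "N (commutator (\<Phi> g) X) \<le> f \<delta> - c * \<delta>"
    proof -
      have "N (commutator (\<Phi> g) X) \<le> (0 - (c * \<delta> - f \<delta>)) * N X"
        using slope by (intro N_commutator_le_oscillation g g_bound X(1)) auto
      also have "\<dots> \<le> (0 - (c * \<delta> - f \<delta>)) * 1"
        using slope X(2) by (intro mult_left_mono) auto
      finally show ?thesis by simp
    qed
    moreover have "N (commutator (\<Phi> (tangent_extension f \<delta> c)) X) \<le> c * \<delta>"
      unfolding \<delta>_def by (rule lipschitz[OF lip[unfolded \<delta>_def]])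
    ultimately show ?thesis by linarith
  next
    case True
    have commutes: "commutator (\<Phi> h) X = 0" if "c-lipschitz_on {0..} h" "h \<in> \<B>" for c h
      using lipschitz[OF that(1)] True N_nonneg[OF commutator_J[OF that(2)]] N_eq_0_iff[OF commutator_J[OF that(2)]]
      by (simp add: \<delta>_def)
    have "\<forall>n. \<exists>c\<ge>0. c-lipschitz_on {0..} (tangent_extension f (1 / real (Suc n)) c)
      \<and> tangent_extension f (1 / real (Suc n)) c \<in> \<B>
      \<and> (\<forall>t\<ge>0. f t \<le> f (1 / real (Suc n)) + c * (t - 1 / real (Suc n)))"
      by (intro allI ext) simp
    from choice[OF this] obtain c where
      c: "\<And>n. 0 \<le> c n" "\<And>n. (c n)-lipschitz_on {0..} (tangent_extension f (1 / real (Suc n)) (c n))"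
        "\<And>n. tangent_extension f (1 / real (Suc n)) (c n) \<in> \<B>"
        "\<And>n t. 0 \<le> t \<Longrightarrow> f t \<le> f (1 / real (Suc n)) + c n * (t - 1 / real (Suc n))"
      by blast
    define h where "h n = tangent_extension f (1 / real (Suc n)) (c n)" for n
    \<comment> \<open>Negated tents that shrink to the point 0; adding a multiple of them corrects the value at 0, where the tangent extensions converge to the right limit of \<open>f\<close> and not to \<open>f 0\<close>.\<close>
    define k where "k n t = - max 0 (1 - real (Suc n) * t)" for n t
    have k_incr: "0 \<le> k n t - k n s" "k n t - k n s \<le> real (Suc n) * (t - s)" if "0 \<le> s" "s \<le> t" for n s t
    proof -
      have "real (Suc n) * s \<le> real (Suc n) * t"
        using that by (intro mult_left_mono) auto
      then show "0 \<le> k n t - k n s" "k n t - k n s \<le> real (Suc n) * (t - s)"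
        unfolding k_def right_diff_distrib by linarith+
    qed
    have k_lip: "(real (Suc n))-lipschitz_on {0..} (k n)" for n
      by (rule increment_lipschitz[OF _ k_incr]) simp
    have k: "k n \<in> \<B>" for n
      by (rule \<B>_mono[OF \<sigma>]) (use k_incr(1) in fastforce)
    define F where "F n t = h n t + (h n 0 - f 0) * k n t" for n t
    have h: "h n \<in> \<B>" for n
      unfolding h_def by (rule c(3))
    have F: "F n \<in> \<B>" for n
      unfolding F_def by (intro \<B>_add \<B>_scale h k)
    have "commutator (\<Phi> f) X = 0"
    proof (rule \<Phi>_limit_commutes[OF f F])
      show "commutator (\<Phi> (F n)) X = 0" for n
      proof -
        have "\<Phi> (F n) = \<Phi> (h n) + (h n 0 - f 0) *\<^sub>R \<Phi> (k n)"
          unfolding F_def by (simp only: \<Phi>_add[OF h \<B>_scale[OF k]] \<Phi>_scale[OF k])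
        moreover have "commutator (\<Phi> (h n)) X = 0"
          unfolding h_def by (rule commutes[OF c(2,3)])
        moreover have "commutator (\<Phi> (k n)) X = 0"
          by (rule commutes[OF k_lip k])
        ultimately show ?thesis
          by (simp add: commutator_add commutator_scaleR)
      qed
      have h_bound: "0 \<le> h n t \<and> h n t \<le> f (M + 1)" if "0 \<le> t" "t \<le> M" for n t
      proof -
        have "h n t \<ge> f t"
          using c(4)[OF that(1), of n] by (simp add: h_def tangent_extension_def del: of_nat_Suc)
        moreover have "h n t \<le> max (f t) (f (1 / real (Suc n)))"
          using c(1)[of n] by (auto simp: h_def tangent_extension_def le_max_iff_disj mult_nonneg_nonpos simp del: of_nat_Suc)
        moreover have "f t \<le> f (M + 1)"
          using that by (intro mono) auto
        moreover have "f (1 / real (Suc n)) \<le> f (M + 1)"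
        proof (rule mono)
          have "1 / real (Suc n) \<le> 1" by simp
          also have "1 \<le> M + 1" using that by simp
          finally show "1 / real (Suc n) \<le> M + 1" .
          show "0 \<le> 1 / real (Suc n)" by (rule divide_nonneg_nonneg) simp_all
        qed
        ultimately show ?thesis
          using nonneg[OF that(1)] by auto
      qed
      show "\<bar>F n t\<bar> \<le> 2 * f (M + 1)" if "t \<in> \<sigma>" for n t
      proof -
        have t: "0 \<le> t" "t \<le> M"
          using that \<sigma> by auto
        have "\<bar>k n t\<bar> \<le> 1"
          using t by (simp add: k_def max_def)
        moreover have "f 0 \<le> h n 0"
          using c(4)[of 0 n] by (simp add: h_def tangent_extension_def del: of_nat_Suc)
        then have "\<bar>h n 0 - f 0\<bar> \<le> f (M + 1)"
          using h_bound[of 0 n] t nonneg[of 0] by simp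
        ultimately have "\<bar>(h n 0 - f 0) * k n t\<bar> \<le> f (M + 1) * 1"
          unfolding abs_mult by (intro mult_mono) auto
        then show ?thesis
          using h_bound[OF t, of n] unfolding F_def by linarith
      qed
      show "(\<lambda>n. F n t) \<longlonglongrightarrow> f t" if "t \<in> \<sigma>" for t
      proof (cases "t = 0")
        case True
        have "F n 0 = f 0" for n
          by (simp add: F_def k_def)
        then show ?thesis
          using True by simp
      next
        case False
        then have t: "0 < t" using that \<sigma> by fastforce
        obtain m where m: "1 / t < real m"
          using reals_Archimedean2 by blast
        have "F n t = f t" if "m \<le> n" for n
        proof -
          have "1 / t < real (Suc n)"
            using m that by linarith
          then have "1 < real (Suc n) * t"
            using t by (simp add: pos_divide_less_eq del: of_nat_Suc)
          moreover from this have "1 / real (Suc n) < t"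
            by (simp add: pos_divide_less_eq mult.commute del: of_nat_Suc)
          ultimately show ?thesis
            by (simp add: F_def h_def k_def tangent_extension_def del: of_nat_Suc)
        qed
        then show ?thesis
          by (intro tendsto_eventually eventually_sequentiallyI[of m])
      qed
    qed
    then show ?thesis
      using True nonneg[of 0] N_eq_0_iff[OF J_zero] by simp
  qed
  then show ?thesis
    by (simp add: \<delta>_def)
qed

end

text \<open>The commutator Lipschitz norm is an infimum of constants, so the estimate holds with every
constant above \<open>c\<close>, hence with \<open>c\<close>.\<close>

lemma commutator_lipschitz_bound:
  assumes CL: "commutator_lipschitz_norm J N {0..} h = lipschitz_norm {0..} h"
    and lip: "c-lipschitz_on {0..} h"
    and S: "self_adjoint S" "spectrum S \<subseteq> complex_of_real ` {0..}"
    and X: "X \<in> J" and pos: "0 \<le> N (commutator S X)"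
  shows "N (commutator (fun_calc h S) X) \<le> c * N (commutator S X)"
proof -
  let ?K = "{ereal K | K. 0 \<le> K \<and>
       (\<forall>S Y. self_adjoint S \<and> spectrum S \<subseteq> complex_of_real ` {0..} \<and> Y \<in> J \<longrightarrow>
          N (commutator (fun_calc h S) Y) \<le> K * N (commutator S Y))}"
  have "lipschitz_norm {0..} h \<le> ereal c"
    unfolding lipschitz_norm_def using lip by (intro Inf_lower) blast
  then have le: "Inf ?K \<le> ereal c"
    using CL by (simp add: commutator_lipschitz_norm_def)
  have approx: "N (commutator (fun_calc h S) X) \<le> (c + e) * N (commutator S X)" if "0 < e" for e
  proof -
    have "Inf ?K < ereal (c + e)"
      using le that by (simp add: order.strict_trans1)
    then obtain K where "K < c + e" "N (commutator (fun_calc h S) X) \<le> K * N (commutator S X)"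
      unfolding Inf_less_iff using S X by auto
    then show ?thesis
      using mult_right_mono[of K "c + e", OF _ pos] by linarith
  qed
  have bound: "N (commutator (fun_calc h S) X) - c * N (commutator S X) \<le> e * N (commutator S X)" if "0 < e" for e
    using approx[OF that] by (simp add: algebra_simps)
  have "N (commutator (fun_calc h S) X) - c * N (commutator S X) \<le> 0"
  proof (rule field_le_epsilon)
    fix e :: real assume e: "0 < e"
    define n where "n = N (commutator S X)"
    have "0 \<le> n" using pos by (simp add: n_def)
    have "e / (n + 1) * n \<le> e"
      using e \<open>0 \<le> n\<close> by (simp add: divide_le_eq mult_left_mono)
    then show "N (commutator (fun_calc h S) X) - c * N (commutator S X) \<le> 0 + e"
      using bound[of "e / (n + 1)"] e \<open>0 \<le> n\<close> by (simp add: n_def)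
  qed
  then show ?thesis by simp
qed

theorem theorem9p8:
  fixes J :: "('a::complex_hilbert_space \<Rightarrow>\<^sub>L 'a) set"
    and N :: "('a \<Rightarrow>\<^sub>L 'a) \<Rightarrow> real"
    and A X :: "'a \<Rightarrow>\<^sub>L 'a"
    and f :: "real \<Rightarrow> real"
  assumes "\<exists>D::'a set. countable D \<and> closure D = UNIV"
    and "unitarily_invariant_norm J N"
    and "\<And>h. (\<exists>L. L-lipschitz_on {0..} h) \<Longrightarrow>
           commutator_lipschitz_norm J N {0..} h = lipschitz_norm {0..} h"
    and "positive_op A"
    and "X \<in> J" and "N X \<le> 1"
    and "concave_on {0..} f"
    and "\<And>t. t \<ge> 0 \<Longrightarrow> f t \<ge> 0"
  shows "commutator (fun_calc f A) X \<in> J \<and>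
         N (commutator (fun_calc f A) X) \<le> f (N (commutator A X))"
proof -
  define M where "M = norm A + 1"
  interpret A: bounded_positive_operator A M
    unfolding M_def by (rule positive_op_bounded[OF assms(4)])
  have "borel_calculus A (\<lambda>f. fun_calc f A)"
    unfolding fun_calc_def by (rule someI[of "borel_calculus A", OF A.borel_calculus_exists])
  then interpret calculus_in_ideal J N A "\<lambda>f. fun_calc f A"
    by unfold_locales (rule assms(2))
  have "self_adjoint A"
    by (rule A.self_adjoint_A)
  have "A \<in> bounded_ops"
    using \<open>self_adjoint A\<close> by (simp add: self_adjoint_def)
  have spectrum: "spectrum A \<subseteq> complex_of_real ` {0..}"
    using A.spectrum_subset by auto
  have \<sigma>: "real_spectrum A \<subseteq> {0..M}"
    using A.spectrum_subset by (auto simp: real_spectrum_def)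
  have pos: "0 \<le> N (commutator A X)"
    by (intro N_nonneg commutator_in_J \<open>A \<in> bounded_ops\<close> assms(5))
  have lipschitz: "N (commutator (fun_calc h A) X) \<le> c * N (commutator A X)" if "c-lipschitz_on {0..} h" for h c
    using that by (intro commutator_lipschitz_bound[OF assms(3) that] exI \<open>self_adjoint A\<close> spectrum assms(5) pos)
  have "f \<in> bounded_borel_on (real_spectrum A)"
    by (rule \<B>_mono[OF \<sigma> concave_nonneg_mono[OF assms(7,8)]])
  then have "commutator (fun_calc f A) X \<in> J"
    by (intro commutator_in_J \<Phi>_bounded_ops assms(5))
  moreover have "N (commutator (fun_calc f A) X) \<le> f (N (commutator A X))"
    by (rule N_commutator_concave[OF \<sigma> \<open>A \<in> bounded_ops\<close> assms(5,6,7,8) lipschitz])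
  ultimately show ?thesis ..
qed

end
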